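(* Let $m,n\ge 2$ be natural numbers. The groups $\mathrm{Aut}^{(\infty)}(\sigma_m)$ and $\mathrm{Aut}^{(\infty)}(\sigma_n)$ are isomorphic if and only if $m^k=n^j$ for some $k,j\in\mathbb{N}$.
   Context: $(X_n,\sigma_n)$ denotes the full shift on $n$ symbols: $X_n=\mathcal{A}^{\mathbb{Z}}$ with $|\mathcal{A}|=n$ (product topology) and $\sigma_n$ the left shift. For a homeomorphism $T$ of a compact metric space $X$, $\mathrm{Aut}(T)$ is the group of homeomorphisms of $X$ commuting with $T$, and the stabilized automorphism group is $\mathrm{Aut}^{(\infty)}(T)=\bigcup_{k\ge1}\mathrm{Aut}(T^k)$, a subgroup of $\mathrm{Homeo}(X)$. Here $\mathbb{N}$ denotes the positive integers. *)

theory Defs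
  imports "HOL-Analysis.Analysis" "HOL-Algebra.Bij"
begin

text \<open>
  Self-maps of a topological space are represented, as in \<^const>\<open>BijGroup\<close>, by functions that are
  \<^const>\<open>undefined\<close> outside \<^const>\<open>topspace\<close>, so that equality of functions is equality
  on the space. The group operation is composition.
\<close>

definition Homeo :: "'a topology \<Rightarrow> ('a \<Rightarrow> 'a) monoid" where
  "Homeo X = (BijGroup (topspace X)) \<lparr>carrier := {f \<in> extensional (topspace X). homeomorphic_map X X f}\<rparr>"

definition Aut :: "'a topology \<Rightarrow> ('a \<Rightarrow> 'a) \<Rightarrow> ('a \<Rightarrow> 'a) set" where
  "Aut X T = {f \<in> carrier (Homeo X). \<forall>x \<in> topspace X. f (T x) = T (f x)}"

definition stab_Aut :: "'a topology \<Rightarrow> ('a \<Rightarrow> 'a) \<Rightarrow> ('a \<Rightarrow> 'a) set" where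
  "stab_Aut X T = (\<Union>k \<in> {1::nat..}. Aut X (T ^^ k))"

definition stab_Aut_group :: "'a topology \<Rightarrow> ('a \<Rightarrow> 'a) \<Rightarrow> ('a \<Rightarrow> 'a) monoid" where
  "stab_Aut_group X T = (Homeo X) \<lparr>carrier := stab_Aut X T\<rparr>"

definition full_shift :: "'a set \<Rightarrow> (int \<Rightarrow> 'a) topology" where
  "full_shift A = product_topology (\<lambda>_. discrete_topology A) UNIV"

definition shift :: "(int \<Rightarrow> 'a) \<Rightarrow> (int \<Rightarrow> 'a)" where
  "shift x = (\<lambda>i. x (i + 1))"

lemma topspace_full_shift: "topspace (full_shift A) = {x. range x \<subseteq> A}"
  by (auto simp: full_shift_def)

lemma homeomorphic_map_shift: "homeomorphic_map (full_shift A) (full_shift A) shift"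
proof -
  define g :: "(int \<Rightarrow> 'a) \<Rightarrow> (int \<Rightarrow> 'a)" where "g x = (\<lambda>i. x (i - 1))" for x
  have c: "continuous_map (full_shift A) (full_shift A) (\<lambda>x i. x (h i))" for h :: "int \<Rightarrow> int"
    unfolding full_shift_def continuous_map_componentwise_UNIV
    by (auto intro: continuous_map_product_projection)
  have "homeomorphic_maps (full_shift A) (full_shift A) shift g"
    unfolding homeomorphic_maps_def using c[of "\<lambda>i. i + 1"] c[of "\<lambda>i. i - 1"]
    by (simp add: shift_def[abs_def] g_def[abs_def])
  thus ?thesis by (rule homeomorphic_maps_imp_map)
qed

lemma carrier_Homeo_subset_Bij: "carrier (Homeo X) \<subseteq> Bij (topspace X)"
  using homeomorphic_imp_surjective_map homeomorphic_imp_injective_map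
  by (fastforce simp: Homeo_def Bij_def bij_betw_def)

lemma subgroup_Homeo: "subgroup (carrier (Homeo X)) (BijGroup (topspace X))"
proof (rule group.subgroupI[OF group_BijGroup])
  show "carrier (Homeo X) \<subseteq> carrier (BijGroup (topspace X))"
    using carrier_Homeo_subset_Bij by (simp add: BijGroup_def)
  have "restrict (\<lambda>x. x) (topspace X) \<in> carrier (Homeo X)"
    by (auto simp: Homeo_def intro: homeomorphic_map_eq[of X X id])
  thus "carrier (Homeo X) \<noteq> {}" by blast
next
  fix f assume f: "f \<in> carrier (Homeo X)"
  hence b: "f \<in> Bij (topspace X)" using carrier_Homeo_subset_Bij by blast
  from f obtain g where g: "homeomorphic_maps X X f g"
    by (auto simp: Homeo_def homeomorphic_map_maps)
  have e: "g x = inv_into (topspace X) f x" if "x \<in> topspace X" for x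
    using g that b unfolding homeomorphic_maps_def Bij_def bij_betw_def continuous_map_def
    by (metis (no_types, lifting) PiE inv_into_f_f IntD2 mem_Collect_eq)
  have "homeomorphic_map X X g"
    using g homeomorphic_maps_sym homeomorphic_maps_imp_map by blast
  hence "homeomorphic_map X X (restrict (inv_into (topspace X) f) (topspace X))"
    by (rule homeomorphic_map_eq) (simp add: e)
  thus "inv\<^bsub>BijGroup (topspace X)\<^esub> f \<in> carrier (Homeo X)"
    by (simp add: inv_BijGroup[OF b] Homeo_def)
next
  fix f g assume fg: "f \<in> carrier (Homeo X)" "g \<in> carrier (Homeo X)"
  hence b: "f \<in> Bij (topspace X)" "g \<in> Bij (topspace X)"
    using carrier_Homeo_subset_Bij by blast+
  have "homeomorphic_map X X (f \<circ> g)"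
    using fg homeomorphic_map_compose[of X X g X f] by (auto simp: Homeo_def)
  hence "homeomorphic_map X X (compose (topspace X) f g)"
    by (rule homeomorphic_map_eq) (simp add: compose_def)
  thus "f \<otimes>\<^bsub>BijGroup (topspace X)\<^esub> g \<in> carrier (Homeo X)"
    using b by (simp add: BijGroup_def Homeo_def)
qed

lemma group_Homeo: "group (Homeo X)"
  using group.subgroup_imp_group[OF group_BijGroup subgroup_Homeo[of X]]
  by (simp add: Homeo_def)

lemma mult_Homeo:
  "f \<in> carrier (Homeo X) \<Longrightarrow> g \<in> carrier (Homeo X) \<Longrightarrow>
    f \<otimes>\<^bsub>Homeo X\<^esub> g = compose (topspace X) f g"
  using carrier_Homeo_subset_Bij[of X] by (auto simp: Homeo_def BijGroup_def)

lemma one_Homeo: "\<one>\<^bsub>Homeo X\<^esub> = restrict (\<lambda>x. x) (topspace X)"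
  by (simp add: Homeo_def BijGroup_def)

lemma Homeo_in_topspace: "f \<in> carrier (Homeo X) \<Longrightarrow> x \<in> topspace X \<Longrightarrow> f x \<in> topspace X"
  using homeomorphic_imp_surjective_map by (fastforce simp: Homeo_def)

lemma Aut_funpow:
  assumes "f \<in> Aut X T" and T: "T \<in> topspace X \<rightarrow> topspace X"
  shows "f \<in> Aut X (T ^^ k)"
proof -
  have "f ((T ^^ k) x) = (T ^^ k) (f x) \<and> (T ^^ k) x \<in> topspace X" if "x \<in> topspace X" for x
    using that assms by (induction k) (auto simp: Aut_def)
  thus ?thesis using assms(1) by (auto simp: Aut_def)
qed

lemma subgroup_stab_Aut:
  assumes "homeomorphic_map X X T"
  shows "subgroup (stab_Aut X T) (Homeo X)"
proof (rule group.subgroupI[OF group_Homeo])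
  have T: "(T ^^ k) \<in> topspace X \<rightarrow> topspace X" for k
    using homeomorphic_imp_surjective_map[OF assms] by (induction k) (auto simp: Pi_iff)
  show "stab_Aut X T \<subseteq> carrier (Homeo X)" by (auto simp: stab_Aut_def Aut_def)
  have "\<one>\<^bsub>Homeo X\<^esub> \<in> Aut X (T ^^ 1)"
    using T[of 1] group.is_monoid[OF group_Homeo, THEN monoid.one_closed, of X]
    by (auto simp: Aut_def one_Homeo)
  thus "stab_Aut X T \<noteq> {}" unfolding stab_Aut_def by blast
  fix f assume "f \<in> stab_Aut X T"
  then obtain k where k: "k \<ge> 1" "f \<in> Aut X (T ^^ k)" by (auto simp: stab_Aut_def)
  {
    let ?i = "inv\<^bsub>Homeo X\<^esub> f"
    have fc: "f \<in> carrier (Homeo X)" using k by (simp add: Aut_def)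
    hence ic: "?i \<in> carrier (Homeo X)" by (rule group.inv_closed[OF group_Homeo])
    have fi: "f (?i x) = x" and if': "?i (f x) = x" if "x \<in> topspace X" for x
      using group.r_inv[OF group_Homeo fc] group.l_inv[OF group_Homeo fc] that
        mult_Homeo[OF fc ic] mult_Homeo[OF ic fc]
      by (simp_all add: one_Homeo) (metis compose_eq restrict_apply')+
    have "?i ((T ^^ k) x) = (T ^^ k) (?i x)" if x: "x \<in> topspace X" for x
    proof -
      have ix: "?i x \<in> topspace X" using Homeo_in_topspace[OF ic x] .
      have "f ((T ^^ k) (?i x)) = (T ^^ k) x"
        using k(2) ix fi[OF x] by (simp add: Aut_def)
      moreover have "(T ^^ k) (?i x) \<in> topspace X" using T[of k] ix by blast
      ultimately show ?thesis using if' by metis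
    qed
    thus "?i \<in> stab_Aut X T" using k(1) ic by (auto simp: stab_Aut_def Aut_def)
  }
  fix g assume "g \<in> stab_Aut X T"
  then obtain l where l: "l \<ge> 1" "g \<in> Aut X (T ^^ l)" by (auto simp: stab_Aut_def)
  have f': "f \<in> Aut X (T ^^ (k * l))"
    using Aut_funpow[OF k(2) T, of l] by (simp add: funpow_mult mult.commute)
  have g': "g \<in> Aut X (T ^^ (k * l))"
    using Aut_funpow[OF l(2) T, of k] by (simp add: funpow_mult mult.commute)
  have fc: "f \<in> carrier (Homeo X)" and gc: "g \<in> carrier (Homeo X)"
    using k l by (simp_all add: Aut_def)
  have "f \<otimes>\<^bsub>Homeo X\<^esub> g \<in> Aut X (T ^^ (k * l))"
    using f' g' T[of "k * l"] monoid.m_closed[OF group.is_monoid[OF group_Homeo] fc gc]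
      Homeo_in_topspace[OF gc]
    by (auto simp: Aut_def mult_Homeo[OF fc gc] compose_def Pi_iff)
  moreover have "k * l \<ge> 1" using k(1) l(1) by simp
  ultimately show "f \<otimes>\<^bsub>Homeo X\<^esub> g \<in> stab_Aut X T" unfolding stab_Aut_def by blast
qed

lemma group_stab_Aut_group: "homeomorphic_map X X T \<Longrightarrow> group (stab_Aut_group X T)"
  unfolding stab_Aut_group_def
  by (rule group.subgroup_imp_group[OF group_Homeo subgroup_stab_Aut])

end

theory Submission
  imports Defs
begin

text \<open>
  If \<open>m ^ k = n ^ j\<close>, then recoding \<open>k\<close>-blocks over \<open>A\<close> as \<open>j\<close>-blocks over \<open>B\<close> conjugates the
  \<open>k\<close>-th power of one shift to the \<open>j\<close>-th power of the other, and the stabilized automorphism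
  group does not change when the shift is replaced by a power.

  Conversely let \<open>\<Psi>\<close> be an isomorphism and \<open>h\<close> the preimage of the shift of \<open>B\<close>. Every element of
  the stabilized group commutes with a power of \<open>h\<close>, so a single power of \<open>h\<close> commutes with any
  given finite set of elements. There is a finite set whose centralizer consists of the powers of
  the shift alone (a finitary form of Ryan's theorem, simple here because maps that only commute
  with the third power of the shift are available). Hence \<open>\<Psi>\<close> maps the \<open>P\<close>-th power of one shift
  to the \<open>Q\<close>-th power of the other, with \<open>P\<close> and \<open>Q\<close> nonzero. For a multiple \<open>w = P t\<close>, the
  symmetric group on the words of length \<open>w\<close> over \<open>A\<close> acts on blocks, and through \<open>\<Psi>\<close> it acts on
  the \<open>n ^ \<bar>Q t\<bar>\<close> points of period \<open>Q t\<close> over \<open>B\<close>. A nontrivial kernel would contain every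
  even permutation of the words, in particular a letterwise permutation independent of \<open>t\<close>; but
  its image under \<open>\<Psi>\<close> is nontrivial, hence moves some periodic point when \<open>t\<close> is large. So the
  action is faithful, whence \<open>fact (m ^ (P t)) \<le> fact (n ^ \<bar>Q t\<bar>)\<close> and \<open>m ^ P \<le> n ^ \<bar>Q\<bar>\<close>. The
  inverse of \<open>\<Psi>\<close> gives the reverse inequality.
\<close>

section \<open>Continuous maps between full shifts\<close>

abbreviation confs :: "'a set \<Rightarrow> (int \<Rightarrow> 'a) set" where
  "confs A \<equiv> topspace (full_shift A)"

lemma confs_iff: "x \<in> confs A \<longleftrightarrow> (\<forall>i. x i \<in> A)"
  by (auto simp: topspace_full_shift)

lemma openin_cylinder:
  assumes "finite J"
  shows "openin (full_shift A) {y \<in> confs A. \<forall>j\<in>J. y j = x j}"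
proof -
  have eq: "{y \<in> confs A. \<forall>j\<in>J. y j = x j} = (\<Pi>\<^sub>E i\<in>UNIV. if i \<in> J then A \<inter> {x i} else A)"
    by (auto simp: confs_iff PiE_iff split: if_splits)
  have "finite {i. (if i \<in> J then A \<inter> {x i} else A) \<noteq> A}"
    by (rule finite_subset[OF _ assms]) auto
  then show ?thesis
    unfolding eq by (auto simp: full_shift_def openin_PiE_gen)
qed

text \<open>Into a product of discrete spaces, continuity is local constancy of each output
  coordinate; the cylinder over the finite set \<open>J\<close> is a neighbourhood on which
  coordinate \<open>i\<close> is constant.\<close>

lemma continuous_map_finite_dependence:
  assumes "g ` confs A \<subseteq> confs B"
    and dep: "\<And>i. \<exists>J. finite J \<and> (\<forall>x\<in>confs A. \<forall>y\<in>confs A. (\<forall>j\<in>J. x j = y j) \<longrightarrow> g x i = g y i)"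
  shows "continuous_map (full_shift A) (full_shift B) g"
proof -
  have "continuous_map (full_shift A) (discrete_topology B) (\<lambda>x. g x i)" for i
  proof -
    obtain J where J: "finite J"
      and J': "\<And>x y. x \<in> confs A \<Longrightarrow> y \<in> confs A \<Longrightarrow> (\<forall>j\<in>J. x j = y j) \<Longrightarrow> g x i = g y i"
      using dep[of i] by blast
    have "openin (full_shift A) {x \<in> confs A. g x i \<in> U}" for U
    proof (subst openin_subopen, safe)
      fix x assume x: "x \<in> confs A" "g x i \<in> U"
      show "\<exists>T. openin (full_shift A) T \<and> x \<in> T \<and> T \<subseteq> {x \<in> confs A. g x i \<in> U}"
      proof (intro exI conjI)
        show "openin (full_shift A) {y \<in> confs A. \<forall>j\<in>J. y j = x j}"
          by (rule openin_cylinder[OF J])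
        show "{y \<in> confs A. \<forall>j\<in>J. y j = x j} \<subseteq> {x \<in> confs A. g x i \<in> U}"
          using J'[OF _ x(1)] x(2) by auto
      qed (use x in auto)
    qed
    moreover have "g x i \<in> B" if "x \<in> confs A" for x
      using assms(1) that by (auto simp: confs_iff image_subset_iff)
    ultimately show ?thesis
      by (auto simp: continuous_map_def)
  qed
  then show ?thesis
    by (simp add: full_shift_def continuous_map_componentwise_UNIV)
qed

lemma compact_full_shift: "finite A \<Longrightarrow> compact_space (full_shift A)"
  by (simp add: full_shift_def compact_space_product_topology compact_space_discrete_topology)

text \<open>Compactness makes the local windows uniform, as in the Curtis-Hedlund-Lyndon theorem. No
  commutation with a shift is assumed, so the radius depends on the coordinate
  \<open>i\<close>.\<close>

lemma continuous_map_window: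
  assumes "finite A" and f: "continuous_map (full_shift A) (full_shift B) f"
  obtains r where "\<And>x y. \<lbrakk>x \<in> confs A; y \<in> confs A; \<And>j. \<bar>j\<bar> \<le> r \<Longrightarrow> x j = y j\<rbrakk> \<Longrightarrow> f x i = f y i"
proof -
  have loc: "\<exists>r. \<forall>y\<in>confs A. (\<forall>j\<in>{-r..r}. y j = x j) \<longrightarrow> f y i = f x i" if x: "x \<in> confs A" for x
  proof -
    have "continuous_map (full_shift A) (discrete_topology B) (\<lambda>x. f x i)"
      using f by (simp add: full_shift_def continuous_map_componentwise_UNIV)
    moreover have "f x i \<in> B"
      using continuous_map_image_subset_topspace[OF f] x by (auto simp: confs_iff image_subset_iff)
    ultimately have "openin (full_shift A) {y \<in> confs A. f y i \<in> {f x i}}"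
      by (intro openin_continuous_map_preimage) auto
    then obtain U where U: "finite {j. U j \<noteq> A}" "x \<in> Pi\<^sub>E UNIV U"
        "Pi\<^sub>E UNIV U \<subseteq> {y \<in> confs A. f y i \<in> {f x i}}"
      using x unfolding full_shift_def openin_product_topology_alt
      by (auto simp: full_shift_def)
    obtain r where r: "\<And>j. U j \<noteq> A \<Longrightarrow> \<bar>j\<bar> \<le> r"
    proof
      fix j assume "U j \<noteq> A"
      then have "\<bar>j\<bar> \<in> abs ` {j. U j \<noteq> A}" by auto
      then show "\<bar>j\<bar> \<le> Max (abs ` {j. U j \<noteq> A})" using U(1) by auto
    qed
    have "f y i = f x i" if y: "y \<in> confs A" "\<forall>j\<in>{-r..r}. y j = x j" for y
    proof -
      have "y j \<in> U j" for j
      proof (cases "U j = A")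
        case True then show ?thesis using y by (simp add: confs_iff)
      next
        case False
        then have "j \<in> {-r..r}" using r[of j] by auto
        then have "y j = x j" using y by blast
        then show ?thesis using U(2) by (auto simp: PiE_iff)
      qed
      then show ?thesis using U(3) by (auto simp: PiE_iff)
    qed
    then show ?thesis by blast
  qed
  then obtain r where r: "\<And>x y. \<lbrakk>x \<in> confs A; y \<in> confs A; \<forall>j\<in>{-r x..r x}. y j = x j\<rbrakk> \<Longrightarrow> f y i = f x i"
    by metis
  define C where "C x = {y \<in> confs A. \<forall>j\<in>{-r x..r x}. y j = x j}" for x
  have "\<exists>F. finite F \<and> F \<subseteq> C ` confs A \<and> confs A \<subseteq> \<Union>F"
    using compact_full_shift[OF assms(1)] unfolding compact_space_alt
    by (rule allE[where x = "C ` confs A"]) (auto simp: C_def openin_cylinder)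
  then obtain F where F: "finite F" "F \<subseteq> confs A" "confs A \<subseteq> (\<Union>x\<in>F. C x)"
    by (metis finite_subset_image)
  \<comment> \<open>The largest radius of the finite subcover works: agreement up to it puts
    \<open>x\<close> and \<open>y\<close> into the same cylinder \<open>C z\<close>, on which
    coordinate \<open>i\<close> of the image is constant.\<close>
  show thesis
  proof
    fix x y assume xy: "x \<in> confs A" "y \<in> confs A"
      "\<And>j. \<bar>j\<bar> \<le> Max (r ` F) \<Longrightarrow> x j = y j"
    obtain z where z: "z \<in> F" "x \<in> C z" using F(3) xy(1) by auto
    have "r z \<le> Max (r ` F)" using F(1) z(1) by simp
    then have "x j = y j" if "j \<in> {-r z..r z}" for j
      using that by (intro xy(3)) auto
    then have "y \<in> C z" using z(2) xy(2) by (auto simp: C_def)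
    then show "f x i = f y i"
      using r[of z x] r[of z y] z F(2) by (auto simp: C_def)
  qed
qed

lemma homeomorphic_maps_finite_dependence:
  assumes "\<And>x. x \<in> confs A \<Longrightarrow> g x \<in> confs B" "\<And>x. x \<in> confs B \<Longrightarrow> g' x \<in> confs A"
    and "\<And>x. x \<in> confs A \<Longrightarrow> g' (g x) = x" "\<And>x. x \<in> confs B \<Longrightarrow> g (g' x) = x"
    and "\<And>i. \<exists>J. finite J \<and> (\<forall>x\<in>confs A. \<forall>y\<in>confs A. (\<forall>j\<in>J. x j = y j) \<longrightarrow> g x i = g y i)"
    and "\<And>i. \<exists>J. finite J \<and> (\<forall>x\<in>confs B. \<forall>y\<in>confs B. (\<forall>j\<in>J. x j = y j) \<longrightarrow> g' x i = g' y i)"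
  shows "homeomorphic_maps (full_shift A) (full_shift B) g g'"
  unfolding homeomorphic_maps_def
  using continuous_map_finite_dependence[of g A B] continuous_map_finite_dependence[of g' B A] assms
  by (simp add: image_subset_iff)

section \<open>Maps commuting with partial shifts and controlled permutations\<close>

text \<open>Integer powers of the shift, so that inverses are again of the form
  \<open>tr k\<close>.\<close>

definition tr :: "int \<Rightarrow> (int \<Rightarrow> 'a) \<Rightarrow> int \<Rightarrow> 'a" where
  "tr k x = (\<lambda>i. x (i + k))"

lemma shift_funpow: "shift ^^ k = tr (int k)"
  by (induction k) (auto simp: tr_def shift_def fun_eq_iff algebra_simps)

lemma tr_tr [simp]: "tr k (tr l x) = tr (k + l) x"
  by (simp add: tr_def fun_eq_iff algebra_simps)

lemma tr_in_confs [simp]: "tr k x \<in> confs A \<longleftrightarrow> x \<in> confs A"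
  by (auto simp: tr_def confs_iff) (metis diff_add_cancel)

text \<open>A configuration is viewed as three interleaved tracks. The partial shift fixes the first track
  and moves the other two; the gate acts on the first track, controlled by the other two.\<close>
definition offtrack_shift :: "int \<Rightarrow> (int \<Rightarrow> 'a) \<Rightarrow> int \<Rightarrow> 'a" where
  "offtrack_shift k x = (\<lambda>i. if 3 dvd i then x i else x (i + 3 * k))"

definition ctrl_gate :: "('a \<Rightarrow> 'a) \<Rightarrow> 'a \<Rightarrow> (int \<Rightarrow> 'a) \<Rightarrow> int \<Rightarrow> 'a" where
  "ctrl_gate p s x = (\<lambda>i. if 3 dvd i \<and> x (i + 1) = s \<and> x (i + 2) = s then p (x i) else x i)"

definition interleave :: "(int \<Rightarrow> 'a) \<Rightarrow> (int \<Rightarrow> 'a) \<Rightarrow> (int \<Rightarrow> 'a) \<Rightarrow> int \<Rightarrow> 'a" where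
  "interleave u v w = (\<lambda>i. if i mod 3 = 0 then u (i div 3) else if i mod 3 = 1 then v (i div 3) else w (i div 3))"

lemma interleave_nth [simp]:
  "interleave u v w (3 * i) = u i" "interleave u v w (3 * i + 1) = v i" "interleave u v w (3 * i + 2) = w i"
  by (simp_all add: interleave_def)

lemma interleave_eqI:
  assumes "\<And>i. x (3 * i) = u i" "\<And>i. x (3 * i + 1) = v i" "\<And>i. x (3 * i + 2) = w i"
  shows "x = interleave u v w"
proof
  fix i :: int
  have "i mod 3 = 0 \<or> i mod 3 = 1 \<or> i mod 3 = 2" by presburger
  then consider j where "i = 3 * j" | j where "i = 3 * j + 1" | j where "i = 3 * j + 2"
    by (metis add.right_neutral mult_div_mod_eq)
  then show "x i = interleave u v w i" using assms by cases simp_all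
qed

lemma interleave_inject: "interleave u v w = interleave u' v' w' \<longleftrightarrow> u = u' \<and> v = v' \<and> w = w'"
  by (metis ext interleave_nth)

lemma interleave_in_confs: "interleave u v w \<in> confs A \<longleftrightarrow> u \<in> confs A \<and> v \<in> confs A \<and> w \<in> confs A"
  unfolding confs_iff by (metis interleave_nth interleave_def)

lemma interleave_cases: "\<exists>u v w. x = interleave u v w"
  using interleave_eqI[of x "\<lambda>i. x (3 * i)" "\<lambda>i. x (3 * i + 1)" "\<lambda>i. x (3 * i + 2)"] by blast

text \<open>The shift rotates the tracks, so what is proved about the first track carries over to
  the other two.\<close>

lemma tr_interleave: "tr 1 (interleave u v w) = interleave v w (tr 1 u)"
proof (rule interleave_eqI)
  fix i :: int
  have "3 * i + 1 + 1 = 3 * i + 2" "3 * i + 2 + 1 = 3 * (i + 1)" by simp_all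
  then show "tr 1 (interleave u v w) (3 * i) = v i" "tr 1 (interleave u v w) (3 * i + 1) = w i"
    "tr 1 (interleave u v w) (3 * i + 2) = tr 1 u i"
    unfolding tr_def by (metis interleave_nth)+
qed

lemma ctrl_gate_interleave:
  "ctrl_gate p s (interleave u v w) = interleave (\<lambda>i. if v i = s \<and> w i = s then p (u i) else u i) v w"
proof (rule interleave_eqI)
  fix i :: int
  have "\<not> 3 dvd 3 * i + 1" "\<not> 3 dvd 3 * i + 2" by presburger+
  then show "ctrl_gate p s (interleave u v w) (3 * i + 1) = v i"
    "ctrl_gate p s (interleave u v w) (3 * i + 2) = w i"
    unfolding ctrl_gate_def by (metis interleave_nth)+
qed (simp add: ctrl_gate_def)

lemma offtrack_shift_interleave:
  "offtrack_shift k (interleave u v w) = interleave u (tr k v) (tr k w)"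
proof (rule interleave_eqI)
  fix i :: int
  have "3 * i + 1 + 3 * k = 3 * (i + k) + 1" "3 * i + 2 + 3 * k = 3 * (i + k) + 2" "\<not> 3 dvd 3 * i + 1" "\<not> 3 dvd 3 * i + 2"
    by presburger+
  then show "offtrack_shift k (interleave u v w) (3 * i + 1) = tr k v i"
    "offtrack_shift k (interleave u v w) (3 * i + 2) = tr k w i"
    unfolding tr_def offtrack_shift_def by (metis interleave_nth)+
qed (simp add: offtrack_shift_def)

text \<open>Commuting with the partial shifts frees the first output track from the other two input
  tracks; rotating the tracks then reduces \<open>f\<close> to a single map \<open>F\<close> on each
  track. Through the gates, \<open>F\<close> acts on sets of positions compatibly with
  intersections, which forces a translation. Since \<open>p\<close> moves every letter, a gate that
  fires is always visible.\<close>

lemma centralizer_translation: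
  fixes f :: "(int \<Rightarrow> 'a) \<Rightarrow> int \<Rightarrow> 'a"
  assumes maps: "\<And>x. x \<in> confs A \<Longrightarrow> f x \<in> confs A"
    and inj: "inj_on f (confs A)"
    and window: "\<And>x y. \<lbrakk>x \<in> confs A; y \<in> confs A; \<And>j. \<bar>j\<bar> \<le> r \<Longrightarrow> x j = y j\<rbrakk> \<Longrightarrow> f x 0 = f y 0"
    and tr: "\<And>x k. x \<in> confs A \<Longrightarrow> f (tr k x) = tr k (f x)"
    and off: "\<And>x k. x \<in> confs A \<Longrightarrow> f (offtrack_shift (int k) x) = offtrack_shift (int k) (f x)"
    and gate: "\<And>x s. x \<in> confs A \<Longrightarrow> s \<in> A \<Longrightarrow> f (ctrl_gate p s x) = ctrl_gate p s (f x)"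
    and p: "\<And>a. a \<in> A \<Longrightarrow> p a \<in> A \<and> p a \<noteq> a"
    and ne: "A \<noteq> {}"
  shows "\<exists>d. \<forall>x\<in>confs A. f x = tr d x"
proof -
  \<comment> \<open>Sliding the other two tracks far away decouples them from the window around coordinate 0.\<close>
  have indep: "f (interleave u v w) 0 = f (interleave u v' w') 0"
    if c: "u \<in> confs A" "v \<in> confs A" "w \<in> confs A" "v' \<in> confs A" "w' \<in> confs A" for u v w v' w'
  proof -
    \<comment> \<open>The window meets only track indices from \<open>- \<bar>r\<bar> - 1\<close> to
      \<open>\<bar>r\<bar>\<close>. Moving by this \<open>k\<close> carries all of them beyond
      \<open>\<bar>r\<bar>\<close>, where \<open>V\<close> and \<open>W\<close> are copies of
      \<open>v'\<close> and \<open>w'\<close>.\<close>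
    define k where "k = nat (2 * \<bar>r\<bar> + 2)"
    define V where "V = (\<lambda>i. if i \<le> \<bar>r\<bar> then v i else v' (i - int k))"
    define W where "W = (\<lambda>i. if i \<le> \<bar>r\<bar> then w i else w' (i - int k))"
    have VW: "V \<in> confs A" "W \<in> confs A" using c by (auto simp: V_def W_def confs_iff)
    have near: "j div 3 \<le> \<bar>r\<bar>" "- \<bar>r\<bar> - 1 \<le> j div 3" if "\<bar>j\<bar> \<le> r" for j
      using that by linarith+
    have "f (interleave u v w) 0 = f (interleave u V W) 0"
      by (rule window) (use c VW near(1) in \<open>simp_all add: interleave_in_confs\<close>,
        use near(1) in \<open>auto simp: interleave_def V_def W_def\<close>)
    \<comment> \<open>Coordinate 0 lies on the first track, which the partial shift leaves in
      place.\<close>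
    also have "\<dots> = offtrack_shift (int k) (f (interleave u V W)) 0"
      by (simp add: offtrack_shift_def)
    also have "\<dots> = f (interleave u (tr k V) (tr k W)) 0"
      using off[of "interleave u V W" k] c VW by (simp add: interleave_in_confs offtrack_shift_interleave)
    also have "\<dots> = f (interleave u v' w') 0"
    proof (rule window)
      fix j assume "\<bar>j\<bar> \<le> r"
      then have "j div 3 + int k > \<bar>r\<bar>" using near(2)[of j] by (simp add: k_def)
      then show "interleave u (tr k V) (tr k W) j = interleave u v' w' j"
        by (auto simp: interleave_def tr_def V_def W_def)
    qed (use c VW in \<open>auto simp: interleave_in_confs\<close>)
    finally show ?thesis .
  qed
  \<comment> \<open>By \<open>indep\<close> the second and third tracks may be filled arbitrarily;
    \<open>u\<close> itself is at hand.\<close>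
  define F where "F u = (\<lambda>i. f (interleave u u u) (3 * i))" for u
  have tr3: "tr (3 * i) (interleave u v w) = interleave (tr i u) (tr i v) (tr i w)" for i and u v w :: "int \<Rightarrow> 'a"
  proof (rule interleave_eqI)
    fix j :: int
    have "3 * j + 3 * i = 3 * (j + i)" "3 * j + 1 + 3 * i = 3 * (j + i) + 1" "3 * j + 2 + 3 * i = 3 * (j + i) + 2"
      by simp_all
    then show "tr (3 * i) (interleave u v w) (3 * j) = tr i u j"
      "tr (3 * i) (interleave u v w) (3 * j + 1) = tr i v j"
      "tr (3 * i) (interleave u v w) (3 * j + 2) = tr i w j"
      unfolding tr_def by (metis interleave_nth)+
  qed
  have F0: "f (interleave u v w) (3 * i) = F u i"
    if c: "u \<in> confs A" "v \<in> confs A" "w \<in> confs A" for u v w i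
  proof -
    have *: "f (interleave u v w) (3 * i) = f (interleave (tr i u) (tr i v) (tr i w)) 0"
      if "u \<in> confs A" "v \<in> confs A" "w \<in> confs A" for u v w
      using tr[of "interleave u v w" "3 * i"] that by (simp add: interleave_in_confs tr3) (simp add: tr_def)
    show ?thesis
      unfolding F_def using *[OF c] *[OF c(1) c(1) c(1)] c
      indep[of "tr i u" "tr i v" "tr i w" "tr i u" "tr i u"] by simp
  qed
  have F_confs: "F u \<in> confs A" if "u \<in> confs A" for u
  proof -
    have "f (interleave u u u) \<in> confs A" using maps that by (simp add: interleave_in_confs)
    then show ?thesis by (simp add: F_def confs_iff)
  qed
  have f_eq: "f (interleave u v w) = interleave (F u) (F v) (F w)"
    if c: "u \<in> confs A" "v \<in> confs A" "w \<in> confs A" for u v w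
  proof (rule interleave_eqI)
    fix i
    \<comment> \<open>One or two shifts bring the second or third track into first position, where
      \<open>F0\<close> applies.\<close>
    have s1: "tr 1 (f (interleave u v w)) = f (interleave v w (tr 1 u))"
      using tr[of "interleave u v w" 1] c by (simp add: interleave_in_confs tr_interleave)
    have s2: "tr 1 (f (interleave v w (tr 1 u))) = f (interleave w (tr 1 u) (tr 1 v))"
      using tr[of "interleave v w (tr 1 u)" 1] c by (simp add: interleave_in_confs tr_interleave)
    show "f (interleave u v w) (3 * i) = F u i" using F0 c by simp
    have "f (interleave u v w) (3 * i + 1) = tr 1 (f (interleave u v w)) (3 * i)"
      by (simp add: tr_def)
    also have "\<dots> = F v i" unfolding s1 using F0 c by simp
    finally show "f (interleave u v w) (3 * i + 1) = F v i" .
    have "f (interleave u v w) (3 * i + 2) = tr 1 (tr 1 (f (interleave u v w))) (3 * i)"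
      by (simp add: tr_def add.commute)
    also have "\<dots> = F w i" unfolding s1 s2 using F0 c by simp
    finally show "f (interleave u v w) (3 * i + 2) = F w i" .
  qed
  have F_inj: "u = u'" if "u \<in> confs A" "u' \<in> confs A" "F u = F u'" for u u'
  proof -
    have "f (interleave u u u) = f (interleave u' u' u')" using that f_eq by simp
    then have "interleave u u u = interleave u' u' u'"
      using inj that by (auto simp: inj_on_def interleave_in_confs)
    then show ?thesis by (simp add: interleave_inject)
  qed
  have F_tr: "F (tr k u) = tr k (F u)" if "u \<in> confs A" for u k
  proof
    fix i
    have "F (tr k u) i = f (tr (3 * k) (interleave u u u)) (3 * i)"
      by (simp add: F_def tr3)
    also have "\<dots> = tr k (F u) i"
      using tr[of "interleave u u u" "3 * k"] that by (simp add: interleave_in_confs) (simp add: F_def tr_def distrib_left)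
    finally show "F (tr k u) i = tr k (F u) i" .
  qed
  have F_gate: "F (\<lambda>i. if v i = s \<and> w i = s then p (u i) else u i)
      = (\<lambda>i. if F v i = s \<and> F w i = s then p (F u i) else F u i)"
    if c: "u \<in> confs A" "v \<in> confs A" "w \<in> confs A" "s \<in> A" for u v w s
  proof -
    have "(\<lambda>i. if v i = s \<and> w i = s then p (u i) else u i) \<in> confs A"
      using c p by (auto simp: confs_iff)
    then show ?thesis
      using gate[of "interleave u v w" s] c
      by (simp add: interleave_in_confs ctrl_gate_interleave f_eq interleave_inject)
  qed
  obtain s0 where s0: "s0 \<in> A" using ne by blast
  define u0 where "u0 = (\<lambda>i::int. s0)"
  have u0: "u0 \<in> confs A" using s0 by (simp add: u0_def confs_iff)
  \<comment> \<open>\<open>N E i\<close>: applying \<open>p\<close> at the positions in \<open>E\<close> before \<open>F\<close> changes the output at \<open>i\<close>. Two controls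
    make \<open>N\<close> compatible with intersections, so it is determined by singletons.\<close>
  define N where "N E i \<longleftrightarrow> F (\<lambda>i. if i \<in> E then p (u0 i) else u0 i) i \<noteq> F u0 i" for E i
  have N_iff: "N ({i. v i = s} \<inter> {i. w i = s}) i \<longleftrightarrow> F v i = s \<and> F w i = s"
    if "v \<in> confs A" "w \<in> confs A" "s \<in> A" for v w s i
    using F_gate[OF u0 that] p F_confs[OF u0] by (auto simp: N_def confs_iff)
  have N1: "N {i. v i = s} i \<longleftrightarrow> F v i = s" if "v \<in> confs A" "s \<in> A" for v s i
    using N_iff[of v v s i] that by simp
  \<comment> \<open>Every set \<open>E\<close> of positions is the level set of a configuration,
    because \<open>p s0\<close> is a letter different from \<open>s0\<close>.\<close>
  define ind where "ind E = (\<lambda>i::int. if i \<in> E then s0 else p s0)" for E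
  have ind: "ind E \<in> confs A" "{i. ind E i = s0} = E" for E
    using s0 p[OF s0] by (auto simp: ind_def confs_iff)
  have N_Int: "N (E \<inter> E') i \<longleftrightarrow> N E i \<and> N E' i" for E E' i
    using N_iff[of "ind E" "ind E'" s0 i] N1[of "ind E" s0 i] N1[of "ind E'" s0 i] s0 ind by simp
  have N_empty: "\<not> N {} i" for i by (simp add: N_def)
  have N_shift: "N {j} (i + j) \<longleftrightarrow> N {0} i" for i j
  proof -
    have "tr j (ind {j}) = ind {0}" by (auto simp: tr_def ind_def)
    then have "F (ind {0}) i = F (ind {j}) (i + j)" using F_tr[OF ind(1)[of "{j}"], of j] by (simp add: tr_def)
    then show ?thesis using N1[of "ind {0}" s0 i] N1[of "ind {j}" s0 "i + j"] s0 ind by simp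
  qed
  \<comment> \<open>If no output noticed a change at position 0, \<open>F\<close> would not be
    injective. Output \<open>d\<close> is the one that reads input 0.\<close>
  obtain d where d: "N {0} d"
  proof (rule ccontr)
    assume "\<not> thesis"
    then have "F (\<lambda>i. if i \<in> {0} then p (u0 i) else u0 i) = F u0" using that by (auto simp: N_def)
    moreover have "(\<lambda>i. if i \<in> {0} then p (u0 i) else u0 i) \<in> confs A"
      using p u0 by (auto simp: confs_iff)
    ultimately have "(\<lambda>i. if i \<in> {0} then p (u0 i) else u0 i) = u0" using F_inj u0 by blast
    from fun_cong[OF this, of 0] have "p (u0 0) = u0 0" by simp
    then show False using p[OF s0] by (simp add: u0_def)
  qed
  have Fd: "F v (i + d) = s \<longleftrightarrow> v i = s" if "v \<in> confs A" "s \<in> A" for v s i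
  proof -
    have i: "N {i} (i + d)" using N_shift[of i d] d by (simp add: add.commute)
    \<comment> \<open>Intersecting the level set with \<open>{i}\<close> leaves either
      \<open>{i}\<close>, which output \<open>i + d\<close> notices, or the empty set, which no
      output notices.\<close>
    have "F v (i + d) = s \<longleftrightarrow> N ({i. v i = s} \<inter> {i}) (i + d)"
      using N1[OF that, of "i + d"] N_Int i by simp
    also have "\<dots> \<longleftrightarrow> v i = s"
      using i N_empty by (cases "v i = s") auto
    finally show ?thesis .
  qed
  have F_eq: "F v = tr (- d) v" if "v \<in> confs A" for v
  proof
    fix i
    show "F v i = tr (- d) v i"
      using Fd[OF that, of "v (i - d)" "i - d"] that by (simp add: tr_def confs_iff)
  qed
  have "f x = tr (3 * - d) x" if "x \<in> confs A" for x
  proof -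
    obtain u v w where "x = interleave u v w" using interleave_cases by blast
    with that show ?thesis by (simp add: interleave_in_confs f_eq F_eq tr3 del: mult_minus_right)
  qed
  then show ?thesis by blast
qed

section \<open>The stabilized automorphism group of a full shift\<close>

abbreviation SG :: "'a set \<Rightarrow> ((int \<Rightarrow> 'a) \<Rightarrow> int \<Rightarrow> 'a) monoid" where
  "SG A \<equiv> stab_Aut_group (full_shift A) shift"

lemma group_SG: "group (SG A)"
  by (rule group_stab_Aut_group[OF homeomorphic_map_shift])

lemma SG_carrier_iff: "f \<in> carrier (SG A) \<longleftrightarrow> f \<in> carrier (Homeo (full_shift A)) \<and>
    (\<exists>k\<ge>1. \<forall>x\<in>confs A. f (tr (int k) x) = tr (int k) (f x))"
  by (auto simp: stab_Aut_group_def stab_Aut_def Aut_def shift_funpow)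

lemma SG_Homeo: "f \<in> carrier (SG A) \<Longrightarrow> f \<in> carrier (Homeo (full_shift A))"
  by (simp add: SG_carrier_iff)

lemma SG_in_confs: "f \<in> carrier (SG A) \<Longrightarrow> x \<in> confs A \<Longrightarrow> f x \<in> confs A"
  by (rule Homeo_in_topspace[OF SG_Homeo])

lemma SG_mult:
  assumes "f \<in> carrier (SG A)" "g \<in> carrier (SG A)" "x \<in> confs A"
  shows "(f \<otimes>\<^bsub>SG A\<^esub> g) x = f (g x)"
  using mult_Homeo[OF SG_Homeo[OF assms(1)] SG_Homeo[OF assms(2)]] assms(3)
  by (simp add: stab_Aut_group_def compose_def)

lemma SG_one: "x \<in> confs A \<Longrightarrow> \<one>\<^bsub>SG A\<^esub> x = x"
  by (simp add: stab_Aut_group_def one_Homeo)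

lemma SG_eqI:
  assumes "f \<in> carrier (SG A)" "g \<in> carrier (SG A)" "\<And>x. x \<in> confs A \<Longrightarrow> f x = g x"
  shows "f = g"
proof (rule extensionalityI)
  show "f \<in> extensional (confs A)" "g \<in> extensional (confs A)"
    using SG_Homeo assms(1,2) by (fastforce simp: Homeo_def)+
qed (rule assms)

lemma SG_inv:
  assumes "f \<in> carrier (SG A)" "x \<in> confs A"
  shows "(inv\<^bsub>SG A\<^esub> f) (f x) = x" "f ((inv\<^bsub>SG A\<^esub> f) x) = x"
proof -
  interpret group "SG A" by (rule group_SG)
  show "(inv\<^bsub>SG A\<^esub> f) (f x) = x" "f ((inv\<^bsub>SG A\<^esub> f) x) = x"
    using SG_mult[of "inv\<^bsub>SG A\<^esub> f" A f x] SG_mult[of f A "inv\<^bsub>SG A\<^esub> f" x] assms SG_one[of x A]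
    by (simp_all add: l_inv r_inv)
qed

lemma SG_inj: "f \<in> carrier (SG A) \<Longrightarrow> inj_on f (confs A)"
  using SG_inv(1) by (metis inj_onI)

lemma SG_continuous: "f \<in> carrier (SG A) \<Longrightarrow> continuous_map (full_shift A) (full_shift A) f"
  using SG_Homeo by (auto simp: Homeo_def dest: homeomorphic_imp_continuous_map)

lemma SG_restrictI:
  assumes h: "homeomorphic_maps (full_shift A) (full_shift A) g g'"
    and k: "k \<ge> 1" "\<And>x. x \<in> confs A \<Longrightarrow> g (tr (int k) x) = tr (int k) (g x)"
  shows "restrict g (confs A) \<in> carrier (SG A)"
proof -
  have "homeomorphic_map (full_shift A) (full_shift A) (restrict g (confs A))"
    using homeomorphic_maps_imp_map[OF h] by (rule homeomorphic_map_eq) simp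
  then show ?thesis
    using k by (auto simp: SG_carrier_iff Homeo_def)
qed

lemma SG_commute_iff:
  assumes "f \<in> carrier (SG A)" "g \<in> carrier (SG A)"
  shows "f \<otimes>\<^bsub>SG A\<^esub> g = g \<otimes>\<^bsub>SG A\<^esub> f \<longleftrightarrow> (\<forall>x\<in>confs A. f (g x) = g (f x))"
proof -
  interpret group "SG A" by (rule group_SG)
  show ?thesis
    using SG_eqI[of "f \<otimes>\<^bsub>SG A\<^esub> g" A "g \<otimes>\<^bsub>SG A\<^esub> f"] assms by (auto simp: SG_mult) (metis SG_mult)
qed

section \<open>Powers of the shift as group elements\<close>

definition trs :: "'a set \<Rightarrow> int \<Rightarrow> (int \<Rightarrow> 'a) \<Rightarrow> int \<Rightarrow> 'a" where
  "trs A k = restrict (tr k) (confs A)"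

lemma trs_apply [simp]: "x \<in> confs A \<Longrightarrow> trs A k x = tr k x"
  by (simp add: trs_def)

lemma tr_0 [simp]: "tr 0 x = x"
  by (simp add: tr_def)

lemma tr_finite_dependence:
  "\<And>i. \<exists>J. finite J \<and> (\<forall>x\<in>S. \<forall>y\<in>S. (\<forall>j\<in>J. x j = y j) \<longrightarrow> tr k x i = tr k y i)"
  unfolding tr_def by (rule_tac x = "{i + k}" in exI) auto

lemma trs_closed [simp]: "trs A k \<in> carrier (SG A)"
  unfolding trs_def
proof (rule SG_restrictI)
  show "homeomorphic_maps (full_shift A) (full_shift A) (tr k) (tr (- k))"
    by (rule homeomorphic_maps_finite_dependence) (simp_all add: tr_finite_dependence)
qed (auto simp: add.commute)

lemma trs_mult: "trs A k \<otimes>\<^bsub>SG A\<^esub> trs A l = trs A (k + l)"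
proof -
  interpret group "SG A" by (rule group_SG)
  show ?thesis by (rule SG_eqI[of _ A]) (simp_all add: SG_mult)
qed

lemma trs_0: "trs A 0 = \<one>\<^bsub>SG A\<^esub>"
proof -
  interpret group "SG A" by (rule group_SG)
  show ?thesis by (rule SG_eqI[of _ A]) (simp_all add: SG_one)
qed

lemma trs_pow: "trs A k [^]\<^bsub>SG A\<^esub> (t::nat) = trs A (k * int t)"
proof -
  interpret group "SG A" by (rule group_SG)
  show ?thesis
    by (induction t) (simp_all add: trs_0 trs_mult distrib_left add.commute)
qed

lemma trs_inv: "inv\<^bsub>SG A\<^esub> trs A k = trs A (- k)"
proof -
  interpret group "SG A" by (rule group_SG)
  show ?thesis by (rule inv_equality) (simp_all add: trs_0 trs_mult)
qed

text \<open>A single \<open>a\<close> among letters \<open>b\<close> gives a configuration without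
  nonzero period, so the shift has infinite order.\<close>

lemma trs_eq_one:
  assumes "a \<in> A" "b \<in> A" "a \<noteq> b" "trs A k = \<one>\<^bsub>SG A\<^esub>"
  shows "k = 0"
proof -
  define x where "x = (\<lambda>i::int. if i = 0 then a else b)"
  have x: "x \<in> confs A" using assms by (simp add: x_def confs_iff)
  have "tr k x 0 = x 0" using assms(4) x by (metis trs_apply SG_one)
  then show ?thesis using assms(3) by (simp add: x_def tr_def split: if_splits)
qed

lemma trs_commute:
  assumes "f \<in> carrier (SG A)"
  shows "f \<otimes>\<^bsub>SG A\<^esub> trs A k = trs A k \<otimes>\<^bsub>SG A\<^esub> f \<longleftrightarrow> (\<forall>x\<in>confs A. f (tr k x) = tr k (f x))"
  unfolding SG_commute_iff[OF assms trs_closed] using SG_in_confs[OF assms] by simp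

lemma SG_commute_trs:
  assumes "f \<in> carrier (SG A)"
  obtains k where "k \<ge> 1" "f \<otimes>\<^bsub>SG A\<^esub> trs A (int k) = trs A (int k) \<otimes>\<^bsub>SG A\<^esub> f"
  using assms trs_commute[OF assms] unfolding SG_carrier_iff by metis

lemma (in group) commute_pow:
  assumes "x \<in> carrier G" "y \<in> carrier G" "x \<otimes> y = y \<otimes> x"
  shows "x \<otimes> y [^] (n::nat) = y [^] n \<otimes> x"
  using assms by (induction n) (simp_all, metis m_assoc nat_pow_closed)

text \<open>Commuting with a power of \<open>h\<close> passes to all multiples of the exponent, so
  the product of the individual exponents serves the whole set.\<close>

lemma finite_commuting_power:
  fixes G (structure)
  assumes "group G" "finite F" "F \<subseteq> carrier G" "h \<in> carrier G"
    and "\<And>f. f \<in> F \<Longrightarrow> \<exists>k\<ge>1::nat. f \<otimes> h [^] k = h [^] k \<otimes> f"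
  shows "\<exists>k\<ge>1::nat. \<forall>f\<in>F. f \<otimes> h [^] k = h [^] k \<otimes> f"
  using assms(2,3,5)
proof (induction F)
  case empty then show ?case by auto
next
  case (insert g F)
  interpret group G by fact
  obtain k where k: "k \<ge> 1" "\<forall>f\<in>F. f \<otimes> h [^] (k::nat) = h [^] k \<otimes> f"
    using insert.IH insert.prems by auto
  obtain l where l: "l \<ge> 1" "g \<otimes> h [^] (l::nat) = h [^] l \<otimes> g"
    using insert.prems(2)[of g] by blast
  have "f \<otimes> h [^] (k * l) = h [^] (k * l) \<otimes> f" if "f \<in> insert g F" for f
  proof (cases "f = g")
    case True
    then show ?thesis
      using commute_pow[of g "h [^] l" k] l insert(4) assms(4) by (simp add: nat_pow_pow mult.commute)
  next
    case False
    then show ?thesis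
      using commute_pow[of f "h [^] k" l] k insert(4) assms(4) that by (auto simp: nat_pow_pow)
  qed
  moreover have "k * l \<ge> 1" using k l by simp
  ultimately show ?case by blast
qed

text \<open>Rotating an enumeration cyclically moves every letter once there are two of them. The
  result drives the gates and later the letterwise permutation.\<close>

lemma ex_derangement:
  assumes "finite A" "card A \<ge> 2"
  shows "\<exists>p. bij_betw p A A \<and> (\<forall>a\<in>A. p a \<noteq> a)"
proof -
  define n where "n = card A"
  obtain h where h: "bij_betw h {0..<n} A"
    using ex_bij_betw_nat_finite[OF assms(1)] n_def by blast
  define c where "c i = Suc i mod n" for i
  have n: "n \<ge> 2" using assms(2) n_def by simp
  have c_ne: "c i \<noteq> i" "c i \<in> {0..<n}" if "i \<in> {0..<n}" for i
    using that n by (auto simp: c_def mod_Suc)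
  have "inj_on c {0..<n}"
    by (rule inj_onI) (auto simp: c_def mod_Suc split: if_splits)
  moreover have "c ` {0..<n} \<subseteq> {0..<n}" using c_ne(2) by blast
  ultimately have c: "bij_betw c {0..<n} {0..<n}"
    using endo_inj_surj[of "{0..<n}" c] by (simp add: bij_betw_def)
  define g where "g = inv_into {0..<n} h"
  have g: "bij_betw g A {0..<n}" unfolding g_def by (rule bij_betw_inv_into[OF h])
  have "bij_betw (h \<circ> c \<circ> g) A A"
    by (intro bij_betw_trans[OF g] bij_betw_trans[OF c] h)
  moreover have "h (c (g a)) \<noteq> a" if "a \<in> A" for a
  proof
    assume *: "h (c (g a)) = a"
    have ga: "g a \<in> {0..<n}" using g that by (auto simp: bij_betw_def)
    have "h (g a) = a" using bij_betw_inv_into_right[OF h that] by (simp add: g_def)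
    then have "c (g a) = g a" using * c_ne(2)[OF ga] ga h by (metis bij_betw_def inj_onD)
    then show False using c_ne(1)[OF ga] by simp
  qed
  ultimately show ?thesis by (intro exI[of _ "h \<circ> c \<circ> g"]) simp
qed

section \<open>Partial shifts and gates as group elements, and their centralizer\<close>

lemma offtrack_shift_add: "offtrack_shift k (offtrack_shift l x) = offtrack_shift (k + l) x"
proof
  fix i :: int
  have "3 dvd i + 3 * k \<longleftrightarrow> 3 dvd i" by presburger
  then show "offtrack_shift k (offtrack_shift l x) i = offtrack_shift (k + l) x i"
    by (simp add: offtrack_shift_def algebra_simps)
qed

lemma offtrack_shift_0 [simp]: "offtrack_shift 0 x = x"
  by (rule ext) (simp add: offtrack_shift_def)

lemma offtrack_shift_closed: "restrict (offtrack_shift k) (confs A) \<in> carrier (SG A)"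
proof (rule SG_restrictI[of _ _ "offtrack_shift (- k)" 3])
  have dep: "\<exists>J. finite J \<and> (\<forall>x\<in>confs A. \<forall>y\<in>confs A. (\<forall>j\<in>J. x j = y j) \<longrightarrow>
    offtrack_shift l x i = offtrack_shift l y i)" for l i
    by (rule exI[of _ "{i, i + 3 * l}"]) (auto simp: offtrack_shift_def)
  have confs: "offtrack_shift l x \<in> confs A" if "x \<in> confs A" for l x
    using that by (simp add: confs_iff offtrack_shift_def)
  show "homeomorphic_maps (full_shift A) (full_shift A) (offtrack_shift k) (offtrack_shift (- k))"
    by (rule homeomorphic_maps_finite_dependence) (simp_all add: confs dep offtrack_shift_add)
  fix x :: "int \<Rightarrow> 'a"
  show "offtrack_shift k (tr (int 3) x) = tr (int 3) (offtrack_shift k x)"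
    by (rule ext) (simp add: offtrack_shift_def tr_def ac_simps)
qed simp

text \<open>A gate changes only positions divisible by 3 and reads its controls elsewhere. The
  controls survive, so the gate of the inverse permutation undoes it; dependence on the class modulo
  3 gives commutation with the third power of the shift.\<close>

lemma ctrl_gate_closed:
  assumes p: "bij_betw p A A" and s: "s \<in> A"
  shows "restrict (ctrl_gate p s) (confs A) \<in> carrier (SG A)"
proof (rule SG_restrictI[of _ _ "ctrl_gate (inv_into A p) s" 3])
  have q: "bij_betw (inv_into A p) A A" by (rule bij_betw_inv_into[OF p])
  have dep: "\<exists>J. finite J \<and> (\<forall>x\<in>confs A. \<forall>y\<in>confs A. (\<forall>j\<in>J. x j = y j) \<longrightarrow>
    ctrl_gate q s x i = ctrl_gate q s y i)" for q i
    by (rule exI[of _ "{i, i + 1, i + 2}"]) (auto simp: ctrl_gate_def)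
  have confs: "ctrl_gate q s x \<in> confs A" if "x \<in> confs A" "bij_betw q A A" for q x
    using that bij_betwE[of q A A] by (auto simp: confs_iff ctrl_gate_def)
  have ndvd: "\<not> 3 dvd i + 1" "\<not> 3 dvd i + 2" if "3 dvd i" for i :: int
    using that by presburger+
  have inverse: "ctrl_gate q' s (ctrl_gate q s x) = x"
    if "x \<in> confs A" "\<And>a. a \<in> A \<Longrightarrow> q' (q a) = a" for q q' x
    using that by (auto simp: ctrl_gate_def confs_iff fun_eq_iff ndvd)
  show "homeomorphic_maps (full_shift A) (full_shift A) (ctrl_gate p s) (ctrl_gate (inv_into A p) s)"
    by (rule homeomorphic_maps_finite_dependence)
      (use p q in \<open>simp_all add: confs dep inverse bij_betw_inv_into_left bij_betw_inv_into_right\<close>)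
  fix x :: "int \<Rightarrow> 'a"
  show "ctrl_gate p s (tr (int 3) x) = tr (int 3) (ctrl_gate p s x)"
    by (rule ext) (simp add: ctrl_gate_def tr_def ac_simps)
qed simp

text \<open>The set consists of the shift, one partial shift and one gate for each letter. An
  element commuting with them has a finite window by compactness, so
  \<open>centralizer_translation\<close> applies.\<close>

lemma finite_set_with_cyclic_centralizer:
  assumes A: "finite A" "card A \<ge> 2"
  shows "\<exists>F. finite F \<and> F \<subseteq> carrier (SG A) \<and>
    (\<forall>f\<in>carrier (SG A). (\<forall>g\<in>F. g \<otimes>\<^bsub>SG A\<^esub> f = f \<otimes>\<^bsub>SG A\<^esub> g) \<longrightarrow> (\<exists>d. f = trs A d))"
proof -
  obtain p where p: "bij_betw p A A" "\<And>a. a \<in> A \<Longrightarrow> p a \<noteq> a"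
    using ex_derangement[OF A] by blast
  define gt where "gt s = restrict (ctrl_gate p s) (confs A)" for s
  define off where "off = restrict (offtrack_shift 1) (confs A)"
  define F where "F = insert (trs A 1) (insert off (gt ` A))"
  have gt: "gt s \<in> carrier (SG A)" if "s \<in> A" for s
    unfolding gt_def by (rule ctrl_gate_closed[OF p(1) that])
  have off: "off \<in> carrier (SG A)" unfolding off_def by (rule offtrack_shift_closed)
  have cen: "\<exists>d. f = trs A d" if f: "f \<in> carrier (SG A)" and comm: "\<And>g. g \<in> F \<Longrightarrow> g \<otimes>\<^bsub>SG A\<^esub> f = f \<otimes>\<^bsub>SG A\<^esub> g" for f
  proof -
    have cm: "g (f x) = f (g x)" if "g \<in> F" "x \<in> confs A" for g x
      using comm[OF that(1)] that SG_commute_iff[of g A f] gt off f by (auto simp: F_def)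
    have trn: "f (tr (int k) x) = tr (int k) (f x)" if "x \<in> confs A" for k x
      using that
    proof (induction k)
      case (Suc k)
      have "f (tr (int (Suc k)) x) = f (trs A 1 (tr (int k) x))" using Suc(2) by simp
      also have "\<dots> = trs A 1 (f (tr (int k) x))" using cm[of "trs A 1" "tr (int k) x"] Suc(2) by (simp add: F_def)
      finally show ?case using Suc SG_in_confs[OF f] by simp
    qed simp
    have trz: "f (tr k x) = tr k (f x)" if "x \<in> confs A" for k x
    proof (cases "k \<ge> 0")
      case True then show ?thesis using trn[OF that, of "nat k"] by simp
    next
      case False
      then have "tr k (f (tr (- k) (tr k x))) = tr k (tr (- k) (f (tr k x)))"
        using trn[of "tr k x" "nat (- k)"] that by simp
      then show ?thesis by simp
    qed
    have offn: "f (offtrack_shift (int k) x) = offtrack_shift (int k) (f x)" if "x \<in> confs A" for k x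
      using that
    proof (induction k)
      case 0 show ?case by simp
    next
      case (Suc k)
      have c: "offtrack_shift (int k) x \<in> confs A" if "x \<in> confs A" for k x
        using that by (simp add: confs_iff offtrack_shift_def)
      have "f (offtrack_shift (int (Suc k)) x) = f (off (offtrack_shift (int k) x))"
        using Suc(2) c by (simp add: off_def offtrack_shift_add)
      also have "\<dots> = off (f (offtrack_shift (int k) x))"
        using cm[of off "offtrack_shift (int k) x"] c Suc(2) by (simp add: F_def)
      finally show ?case using Suc c SG_in_confs[OF f] by (simp add: off_def offtrack_shift_add)
    qed
    obtain r where r: "\<And>x y. \<lbrakk>x \<in> confs A; y \<in> confs A; \<And>j. \<bar>j\<bar> \<le> r \<Longrightarrow> x j = y j\<rbrakk> \<Longrightarrow> f x 0 = f y 0"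
      using continuous_map_window[OF A(1) SG_continuous[OF f]] by blast
    have "\<exists>d. \<forall>x\<in>confs A. f x = tr d x"
    proof (rule centralizer_translation[where p = p and r = r])
      show "f x \<in> confs A" if "x \<in> confs A" for x using SG_in_confs[OF f that] .
      show "f (ctrl_gate p s x) = ctrl_gate p s (f x)" if "x \<in> confs A" "s \<in> A" for x s
        using cm[of "gt s" x] that SG_in_confs[OF f that(1)] by (simp add: gt_def F_def)
      show "p a \<in> A \<and> p a \<noteq> a" if "a \<in> A" for a
        using p that by (auto simp: bij_betw_def)
      show "A \<noteq> {}" using A(2) by auto
      show "inj_on f (confs A)" by (rule SG_inj[OF f])
      show "f (tr k x) = tr k (f x)" if "x \<in> confs A" for x k by (rule trz[OF that])
      show "f (offtrack_shift (int k) x) = offtrack_shift (int k) (f x)" if "x \<in> confs A" for x k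
        by (rule offn[OF that])
      show "f x 0 = f y 0" if "x \<in> confs A" "y \<in> confs A" "\<And>j. \<bar>j\<bar> \<le> r \<Longrightarrow> x j = y j" for x y
        by (rule r[OF that])
    qed
    then obtain d where d: "\<forall>x\<in>confs A. f x = tr d x" ..
    have "f = trs A d" by (rule SG_eqI[OF f trs_closed]) (simp add: d)
    then show ?thesis ..
  qed
  show ?thesis
  proof (intro exI[of _ F] conjI ballI impI)
    show "finite F" "F \<subseteq> carrier (SG A)" using gt off A(1) by (auto simp: F_def)
    show "\<exists>d. f = trs A d"
      if "f \<in> carrier (SG A)" "\<forall>g\<in>F. g \<otimes>\<^bsub>SG A\<^esub> f = f \<otimes>\<^bsub>SG A\<^esub> g" for f
      by (rule cen[OF that(1) bspec[OF that(2)]])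
  qed
qed

lemma iso_maps_shift_power:
  assumes A: "finite A" "card A \<ge> 2" and B: "finite B" "card B \<ge> 2"
    and \<Psi>: "\<Psi> \<in> iso (SG A) (SG B)"
  shows "\<exists>P Q. P \<ge> 1 \<and> Q \<noteq> 0 \<and> \<Psi> (trs A P) = trs B Q"
proof -
  interpret GA: group "SG A" by (rule group_SG)
  interpret GB: group "SG B" by (rule group_SG)
  interpret h: group_hom "SG A" "SG B" \<Psi>
    using \<Psi> by unfold_locales (simp add: iso_def)
  have bij: "bij_betw \<Psi> (carrier (SG A)) (carrier (SG B))" using \<Psi> by (simp add: iso_def)
  then have inj: "inj_on \<Psi> (carrier (SG A))" by (simp add: bij_betw_def)
  have comm_iff: "\<Psi> f \<otimes>\<^bsub>SG B\<^esub> \<Psi> g = \<Psi> g \<otimes>\<^bsub>SG B\<^esub> \<Psi> f \<longleftrightarrow> f \<otimes>\<^bsub>SG A\<^esub> g = g \<otimes>\<^bsub>SG A\<^esub> f"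
    if "f \<in> carrier (SG A)" "g \<in> carrier (SG A)" for f g
    using inj_on_eq_iff[OF inj, of "f \<otimes>\<^bsub>SG A\<^esub> g" "g \<otimes>\<^bsub>SG A\<^esub> f"] that by simp
  have "trs B 1 \<in> \<Psi> ` carrier (SG A)" using bij by (simp add: bij_betw_def)
  then obtain h where h: "h \<in> carrier (SG A)" "\<Psi> h = trs B 1" by force
  obtain F where F: "finite F" "F \<subseteq> carrier (SG A)"
    and F': "\<forall>f\<in>carrier (SG A). (\<forall>g\<in>F. g \<otimes>\<^bsub>SG A\<^esub> f = f \<otimes>\<^bsub>SG A\<^esub> g) \<longrightarrow> (\<exists>d. f = trs A d)"
    using finite_set_with_cyclic_centralizer[OF A] by (elim exE conjE) (rule that)
  \<comment> \<open>\<open>\<Psi> f\<close> commutes with some power of the shift of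
    \<open>B\<close>, which is the image of a power of \<open>h\<close>; injectivity of
    \<open>\<Psi>\<close> pulls the relation back.\<close>
  have "\<exists>k\<ge>1::nat. f \<otimes>\<^bsub>SG A\<^esub> h [^]\<^bsub>SG A\<^esub> k = h [^]\<^bsub>SG A\<^esub> k \<otimes>\<^bsub>SG A\<^esub> f" if "f \<in> F" for f
  proof -
    have f: "f \<in> carrier (SG A)" using that F(2) by blast
    obtain k where "k \<ge> 1" "\<Psi> f \<otimes>\<^bsub>SG B\<^esub> trs B (int k) = trs B (int k) \<otimes>\<^bsub>SG B\<^esub> \<Psi> f"
      using SG_commute_trs[OF h.hom_closed[OF f]] by blast
    moreover have "\<Psi> (h [^]\<^bsub>SG A\<^esub> k) = trs B (int k)"
      using h by (simp add: h.hom_nat_pow trs_pow)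
    ultimately show ?thesis using comm_iff[of f "h [^]\<^bsub>SG A\<^esub> k"] f h(1) by auto
  qed
  then obtain k :: nat where k: "k \<ge> 1"
    and k': "\<forall>f\<in>F. f \<otimes>\<^bsub>SG A\<^esub> h [^]\<^bsub>SG A\<^esub> k = h [^]\<^bsub>SG A\<^esub> k \<otimes>\<^bsub>SG A\<^esub> f"
    using finite_commuting_power[OF group_SG F(1,2) h(1)] by blast
  then obtain d where d: "h [^]\<^bsub>SG A\<^esub> k = trs A d"
    using bspec[OF F', of "h [^]\<^bsub>SG A\<^esub> k"] h(1) by auto
  have \<Psi>d: "\<Psi> (trs A d) = trs B (int k)"
    using h by (simp add: d[symmetric] h.hom_nat_pow trs_pow)
  obtain b b' where b: "b \<in> B" "b' \<in> B" "b \<noteq> b'"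
    using B(2) by (metis card_le_Suc0_iff_eq B(1) not_less_eq_eq numeral_2_eq_2)
  have d0: "d \<noteq> 0"
  proof
    assume "d = 0"
    then have "trs B (int k) = \<one>\<^bsub>SG B\<^esub>" using \<Psi>d by (simp add: trs_0)
    then show False using trs_eq_one[OF b, of "int k"] k by simp
  qed
  \<comment> \<open>The sign of \<open>d\<close> is unknown; if it is negative, inverting both sides
    makes the source exponent positive and leaves a negative target exponent.\<close>
  have \<Psi>_neg: "\<Psi> (trs A (- d)) = trs B (- int k)"
    using \<Psi>d h.hom_inv[of "trs A d"] by (simp add: trs_inv)
  show ?thesis
  proof (cases "d > 0")
    case True
    then have "d \<ge> 1 \<and> int k \<noteq> 0" using k by simp
    then show ?thesis using \<Psi>d by blast
  next
    case False
    then have "- d \<ge> 1 \<and> - int k \<noteq> 0" using k d0 by simp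
    then show ?thesis using \<Psi>_neg by blast
  qed
qed

section \<open>Block recodings\<close>

definition words :: "'a set \<Rightarrow> int \<Rightarrow> (int \<Rightarrow> 'a) set" where
  "words A w = {0..<w} \<rightarrow>\<^sub>E A"

definition word :: "int \<Rightarrow> (int \<Rightarrow> 'a) \<Rightarrow> int \<Rightarrow> int \<Rightarrow> 'a" where
  "word w x q = (\<lambda>r\<in>{0..<w}. x (w * q + r))"

text \<open>A block code that may change the block length: it intertwines the \<open>w\<close>-th
  power of the shift on one side with the \<open>v\<close>-th power on the other.\<close>

definition recode :: "int \<Rightarrow> int \<Rightarrow> ((int \<Rightarrow> 'a) \<Rightarrow> int \<Rightarrow> 'b) \<Rightarrow> (int \<Rightarrow> 'a) \<Rightarrow> int \<Rightarrow> 'b" where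
  "recode w v e x = (\<lambda>i. e (word w x (i div v)) (i mod v))"

lemma finite_words: "finite A \<Longrightarrow> finite (words A w)"
  by (simp add: words_def finite_PiE)

lemma card_words: "card (words A w) = card A ^ nat w"
  by (simp add: words_def card_PiE)

lemma word_in_words: "x \<in> confs A \<Longrightarrow> word w x q \<in> words A w"
  by (simp add: word_def words_def confs_iff)

lemma words_nth: "u \<in> words A w \<Longrightarrow> 0 < w \<Longrightarrow> u (i mod w) \<in> A"
  by (auto simp: words_def)

lemma word_nth: "0 < w \<Longrightarrow> word w x (i div w) (i mod w) = x i"
  by (simp add: word_def)

lemma word_recode:
  assumes "e \<in> words A w \<rightarrow> words B v" "x \<in> confs A"
  shows "word v (recode w v e x) q = e (word w x q)"
proof
  fix r
  have "e (word w x q) \<in> words B v" using assms word_in_words by blast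
  then show "word v (recode w v e x) q r = e (word w x q) r"
    by (cases "r \<in> {0..<v}") (auto simp: word_def recode_def words_def PiE_def extensional_def)
qed

lemma recode_in_confs:
  assumes "e \<in> words A w \<rightarrow> words B v" "0 < v" "x \<in> confs A"
  shows "recode w v e x \<in> confs B"
proof -
  have "e (word w x q) \<in> words B v" for q using assms word_in_words by blast
  then show ?thesis using assms(2) by (simp add: recode_def confs_iff words_nth)
qed

lemma recode_recode:
  assumes "e \<in> words A w \<rightarrow> words B v" "x \<in> confs A"
  shows "recode v u e' (recode w v e x) = recode w u (e' \<circ> e) x"
  by (rule ext) (simp add: recode_def[of v u] recode_def[of w u] word_recode[OF assms])

lemma recode_ident:
  assumes "0 < w" "x \<in> confs A" "\<And>u. u \<in> words A w \<Longrightarrow> e u = u"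
  shows "recode w w e x = x"
  by (rule ext) (simp add: recode_def assms(3)[OF word_in_words[OF assms(2)]] word_nth[OF assms(1)])

lemma recode_tr:
  assumes "0 < v"
  shows "recode w v e (tr (w * k) x) = tr (v * k) (recode w v e x)"
proof -
  have "word w (tr (w * k) x) q = word w x (q + k)" for q
    by (auto simp: word_def tr_def algebra_simps)
  then show ?thesis
    unfolding recode_def using assms by (intro ext) (simp add: tr_def add.commute)
qed

lemma homeomorphic_maps_recode:
  assumes e: "bij_betw e (words A w) (words B v)" and "0 < w" "0 < v"
  shows "homeomorphic_maps (full_shift A) (full_shift B) (recode w v e) (recode v w (inv_into (words A w) e))"
proof -
  have dep: "\<exists>J. finite J \<and> (\<forall>x\<in>S. \<forall>y\<in>S. (\<forall>j\<in>J. x j = y j) \<longrightarrow> recode w v e x i = recode w v e y i)"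
    for w v i and e :: "(int \<Rightarrow> 'c) \<Rightarrow> int \<Rightarrow> 'd" and S
  proof (intro exI conjI ballI impI)
    fix x y :: "int \<Rightarrow> 'c" assume "\<forall>j\<in>{w * (i div v)..<w * (i div v) + w}. x j = y j"
    then have "word w x (i div v) = word w y (i div v)" by (auto simp: word_def restrict_def)
    then show "recode w v e x i = recode w v e y i" by (simp add: recode_def)
  qed simp
  let ?e' = "inv_into (words A w) e"
  have e1: "e \<in> words A w \<rightarrow> words B v" and e2: "?e' \<in> words B v \<rightarrow> words A w"
    using e bij_betw_inv_into[OF e] by (auto dest: bij_betwE)
  show ?thesis
  proof (rule homeomorphic_maps_finite_dependence)
    show "recode v w ?e' (recode w v e x) = x" if "x \<in> confs A" for x
      unfolding recode_recode[OF e1 that] using e assms that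
      by (intro recode_ident) (auto simp: bij_betw_inv_into_left)
    show "recode w v e (recode v w ?e' x) = x" if "x \<in> confs B" for x
      unfolding recode_recode[OF e2 that] using e assms that
      by (intro recode_ident) (auto simp: bij_betw_inv_into_right)
    show "recode w v e x \<in> confs B" if "x \<in> confs A" for x
      by (rule recode_in_confs[OF e1 assms(3) that])
    show "recode v w ?e' x \<in> confs A" if "x \<in> confs B" for x
      by (rule recode_in_confs[OF e2 assms(2) that])
  qed (rule dep)+
qed

section \<open>Conjugation by a block recoding\<close>

lemma SG_commute_multiple:
  assumes "f \<in> carrier (SG A)" "x \<in> confs A" "\<And>x. x \<in> confs A \<Longrightarrow> f (tr (int k) x) = tr (int k) (f x)"
  shows "f (tr (int k * int l) x) = tr (int k * int l) (f x)"
proof -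
  interpret group "SG A" by (rule group_SG)
  have "f \<otimes>\<^bsub>SG A\<^esub> trs A (int k) = trs A (int k) \<otimes>\<^bsub>SG A\<^esub> f"
    using assms trs_commute by blast
  then show ?thesis
    using commute_pow[of f "trs A (int k)" l] assms(1,2) trs_commute[OF assms(1)] by (simp add: trs_pow)
qed

text \<open>If \<open>f\<close> commutes with the \<open>N\<close>-th power of the shift, it also
  commutes with the power \<open>k * N\<close>, which the recoding turns into the power
  \<open>j * N\<close> over \<open>B\<close>.\<close>

lemma SG_conj_closed:
  assumes e: "bij_betw e (words A k) (words B j)" and kj: "0 < k" "0 < j"
    and f: "f \<in> carrier (SG A)"
  shows "restrict (\<lambda>y. recode k j e (f (recode j k (inv_into (words A k) e) y))) (confs B) \<in> carrier (SG B)"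
proof -
  interpret group "SG A" by (rule group_SG)
  let ?e' = "inv_into (words A k) e"
  let ?f' = "inv\<^bsub>SG A\<^esub> f"
  have h: "homeomorphic_maps (full_shift A) (full_shift B) (recode k j e) (recode j k ?e')"
    by (rule homeomorphic_maps_recode[OF e kj])
  have hf: "homeomorphic_maps (full_shift A) (full_shift A) f ?f'"
    unfolding homeomorphic_maps_def using SG_continuous[OF f] SG_continuous[of ?f' A] f SG_inv[OF f] by simp
  have h': "homeomorphic_maps (full_shift B) (full_shift A) (recode j k ?e') (recode k j e)"
    by (rule iffD1[OF homeomorphic_maps_sym h])
  have H: "homeomorphic_maps (full_shift B) (full_shift B)
    ((recode k j e \<circ> f) \<circ> recode j k ?e') (recode k j e \<circ> (?f' \<circ> recode j k ?e'))"
    by (rule homeomorphic_maps_compose[OF conjI[OF h' homeomorphic_maps_compose[OF conjI[OF hf h]]]])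
  obtain N where N: "N \<ge> 1" "\<And>x. x \<in> confs A \<Longrightarrow> f (tr (int N) x) = tr (int N) (f x)"
    using f by (auto simp: SG_carrier_iff)
  have e': "?e' \<in> words B j \<rightarrow> words A k" using bij_betw_inv_into[OF e] by (auto dest: bij_betwE)
  have comm: "recode k j e (f (recode j k ?e' (tr (j * int N) y)))
      = tr (j * int N) (recode k j e (f (recode j k ?e' y)))" if y: "y \<in> confs B" for y
  proof -
    have "f (tr (k * int N) (recode j k ?e' y)) = tr (k * int N) (f (recode j k ?e' y))"
      using SG_commute_multiple[OF f recode_in_confs[OF e' kj(1) y] N(2), of "nat k"] kj
      by (simp add: mult.commute)
    then show ?thesis using kj by (simp add: recode_tr)
  qed
  show ?thesis
  proof (rule SG_restrictI[where k = "nat j * N"])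
    show "homeomorphic_maps (full_shift B) (full_shift B)
      (\<lambda>y. recode k j e (f (recode j k ?e' y))) (recode k j e \<circ> (?f' \<circ> recode j k ?e'))"
      using H by (simp add: comp_def)
    show "nat j * N \<ge> 1" using kj N(1) by simp
    fix y assume "y \<in> confs B"
    then show "recode k j e (f (recode j k ?e' (tr (int (nat j * N)) y)))
        = tr (int (nat j * N)) (recode k j e (f (recode j k ?e' y)))"
      using comm[of y] kj(2) by simp
  qed
qed

lemma iso_of_recoding:
  assumes e: "bij_betw e (words A k) (words B j)" and kj: "0 < k" "0 < j"
  shows "SG A \<cong> SG B"
proof -
  interpret GA: group "SG A" by (rule group_SG)
  interpret GB: group "SG B" by (rule group_SG)
  let ?e' = "inv_into (words A k) e"
  let ?e'' = "inv_into (words B j) ?e'"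
  let ?t = "recode k j e" and ?t' = "recode j k ?e'"
  have e': "bij_betw ?e' (words B j) (words A k)" by (rule bij_betw_inv_into[OF e])
  define \<Psi> where "\<Psi> f = restrict (\<lambda>y. ?t (f (?t' y))) (confs B)" for f
  define \<Phi> where "\<Phi> f = restrict (\<lambda>y. ?t' (f (?t y))) (confs A)" for f
  have h: "homeomorphic_maps (full_shift A) (full_shift B) ?t ?t'"
    by (rule homeomorphic_maps_recode[OF e kj])
  then have t: "?t x \<in> confs B" "?t' (?t x) = x" if "x \<in> confs A" for x
    using that by (auto simp: homeomorphic_maps_def continuous_map_def)
  have t': "?t' y \<in> confs A" "?t (?t' y) = y" if "y \<in> confs B" for y
    using that h by (auto simp: homeomorphic_maps_def continuous_map_def)
  have \<Psi>: "\<Psi> f \<in> carrier (SG B)" if "f \<in> carrier (SG A)" for f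
    unfolding \<Psi>_def by (rule SG_conj_closed[OF e kj that])
  \<comment> \<open>\<open>SG_conj_closed\<close> applied to \<open>?e'\<close> yields the inverse
    of the inverse of \<open>e\<close>, which agrees with \<open>e\<close> on words; only words
    occur as blocks.\<close>
  have t_eq: "recode k j ?e'' x = ?t x" if "x \<in> confs A" for x
    using e word_in_words[OF that] by (simp add: recode_def inv_into_inv_into_eq)
  have \<Phi>: "\<Phi> f \<in> carrier (SG A)" if f: "f \<in> carrier (SG B)" for f
  proof -
    have "\<Phi> f = restrict (\<lambda>y. ?t' (f (recode k j ?e'' y))) (confs A)"
      by (auto simp: \<Phi>_def t_eq restrict_def)
    then show ?thesis using SG_conj_closed[OF e' kj(2,1) f] by simp
  qed
  have "\<Psi> \<in> hom (SG A) (SG B)"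
  proof (rule homI)
    fix f g assume fg: "f \<in> carrier (SG A)" "g \<in> carrier (SG A)"
    show "\<Psi> (f \<otimes>\<^bsub>SG A\<^esub> g) = \<Psi> f \<otimes>\<^bsub>SG B\<^esub> \<Psi> g"
    proof (rule SG_eqI[of _ B])
      fix y assume y: "y \<in> confs B"
      have "(\<Psi> f \<otimes>\<^bsub>SG B\<^esub> \<Psi> g) y = \<Psi> f (\<Psi> g y)" using SG_mult \<Psi> fg y by blast
      also have "\<dots> = ?t (f (g (?t' y)))"
        using t t' y SG_in_confs[OF fg(2)] by (simp add: \<Psi>_def)
      finally show "\<Psi> (f \<otimes>\<^bsub>SG A\<^esub> g) y = (\<Psi> f \<otimes>\<^bsub>SG B\<^esub> \<Psi> g) y"
        using SG_mult[OF fg] t' y by (simp add: \<Psi>_def)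
    qed (use \<Psi> fg in auto)
  qed (rule \<Psi>)
  moreover have "bij_betw \<Psi> (carrier (SG A)) (carrier (SG B))"
  proof (rule bij_betw_byWitness[where f' = \<Phi>])
    show "\<forall>f\<in>carrier (SG A). \<Phi> (\<Psi> f) = f"
    proof
      fix f assume f: "f \<in> carrier (SG A)"
      show "\<Phi> (\<Psi> f) = f"
      proof (rule SG_eqI[of _ A])
        fix x assume "x \<in> confs A"
        then show "\<Phi> (\<Psi> f) x = f x" using t SG_in_confs[OF f] by (simp add: \<Phi>_def \<Psi>_def)
      qed (use f \<Phi> \<Psi> in auto)
    qed
    show "\<forall>f\<in>carrier (SG B). \<Psi> (\<Phi> f) = f"
    proof
      fix f assume f: "f \<in> carrier (SG B)"
      show "\<Psi> (\<Phi> f) = f"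
      proof (rule SG_eqI[of _ B])
        fix x assume "x \<in> confs B"
        then show "\<Psi> (\<Phi> f) x = f x" using t' SG_in_confs[OF f] by (simp add: \<Phi>_def \<Psi>_def)
      qed (use f \<Phi> \<Psi> in auto)
    qed
  qed (use \<Psi> \<Phi> in auto)
  ultimately show ?thesis by (auto simp: is_iso_def iso_def)
qed

section \<open>Normal subgroups of the symmetric group\<close>

text \<open>The unqualified names denote matrix transposition and the group inverse here.\<close>
abbreviation tsp :: "'a \<Rightarrow> 'a \<Rightarrow> 'a \<Rightarrow> 'a" where "tsp \<equiv> Transposition.transpose"

abbreviation finv :: "('a \<Rightarrow> 'a) \<Rightarrow> 'a \<Rightarrow> 'a" where "finv \<equiv> inv_into UNIV"

text \<open>Three transpositions bring \<open>a\<close>, \<open>b\<close>, \<open>c\<close> to their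
  targets one after the other, each leaving the earlier targets in place.\<close>

lemma ex_permutes_three:
  assumes "distinct [a, b, c]" "distinct [a', b', c']" "{a, b, c, a', b', c'} \<subseteq> S"
  shows "\<exists>g. g permutes S \<and> g a = a' \<and> g b = b' \<and> g c = c'"
proof -
  define g1 where "g1 = tsp a a'"
  define g2 where "g2 = tsp (g1 b) b'"
  define g3 where "g3 = tsp (g2 (g1 c)) c'"
  have S: "g1 b \<in> S" "g2 (g1 c) \<in> S"
    using assms(3) by (auto simp: g1_def g2_def Transposition.transpose_def)
  have g: "g1 permutes S" "g2 permutes S" "g3 permutes S"
    using assms(3) S by (auto simp: g1_def g2_def g3_def intro!: permutes_swap_id)
  have inj: "inj g1" "inj g2" using g by (auto dest: permutes_inj)
  have 1: "g1 a = a'" by (simp add: g1_def)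
  have "g1 b \<noteq> a'" "a' \<noteq> b'" using 1 inj(1) assms(1,2) by (auto dest: injD)
  then have 2: "g2 a' = a'" "g2 (g1 b) = b'" by (simp_all add: g2_def Transposition.transpose_def)
  have "g1 c \<noteq> a'" "g1 c \<noteq> g1 b" using 1 inj(1) assms(1) by (auto dest: injD)
  then have "g2 (g1 c) \<noteq> a'" "g2 (g1 c) \<noteq> b'" using 2 inj(2) by (metis injD)+
  then have 3: "g3 a' = a'" "g3 b' = b'" "g3 (g2 (g1 c)) = c'"
    using assms(2) by (auto simp: g3_def Transposition.transpose_def)
  show ?thesis
    using g 1 2 3 by (intro exI[of _ "g3 \<circ> g2 \<circ> g1"]) (simp add: permutes_compose)
qed

lemma conj_transpose:
  assumes "bij g" shows "g \<circ> tsp a b \<circ> finv g = tsp (g a) (g b)"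
proof
  fix x
  obtain y where "x = g y" using assms by (meson bij_pointE)
  then show "(g \<circ> tsp a b \<circ> finv g) x = tsp (g a) (g b) x"
    using assms bij_is_inj[OF assms] by (auto simp: Transposition.transpose_def dest: injD)
qed

text \<open>A nontrivial normal subgroup of the symmetric group on at least five points contains the
  alternating group, hence all squares. Speaking of squares avoids signs of permutations.\<close>

lemma normal_permutations_square:
  assumes fin: "finite S" and card: "card S \<ge> 5"
    and K: "\<And>p. p \<in> K \<Longrightarrow> p permutes S"
    and comp: "\<And>p q. p \<in> K \<Longrightarrow> q \<in> K \<Longrightarrow> p \<circ> q \<in> K"
    and inv: "\<And>p. p \<in> K \<Longrightarrow> finv p \<in> K"
    and conj: "\<And>p q. p \<in> K \<Longrightarrow> q permutes S \<Longrightarrow> q \<circ> p \<circ> finv q \<in> K"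
    and k: "k \<in> K" "k \<noteq> id"
    and q: "q permutes S"
  shows "q \<circ> q \<in> K"
proof -
  \<comment> \<open>Five points leave one outside any four; this supplies the auxiliary points
    \<open>y\<close> and \<open>e\<close>.\<close>
  have other: "\<exists>y\<in>S. y \<notin> T" if "card T \<le> 4" "finite T" for T
  proof (rule ccontr)
    assume "\<not> ?thesis"
    then have "S \<subseteq> T" by blast
    then have "card S \<le> card T" by (rule card_mono[OF that(2)])
    then show False using that(1) card by linarith
  qed
  have ks: "k permutes S" using K k by blast
  have id: "id \<in> K"
    using comp[OF k(1) inv[OF k(1)]] permutes_inv_o(1)[OF ks] by simp
  obtain x where x: "k x \<noteq> x" using k(2) by (auto simp: fun_eq_iff)
  then have xS: "x \<in> S" "k x \<in> S"
    using permutes_not_in[OF ks] permutes_in_image[OF ks] by metis+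
  \<comment> \<open>Avoiding \<open>x\<close>, \<open>k x\<close> and the preimage of
    \<open>x\<close> keeps the two transpositions of the commutator below disjoint unless
    \<open>k\<close> fixes \<open>y\<close>.\<close>
  have "card {x, k x, finv k x} \<le> 4" by (simp add: card_insert_if)
  then obtain y where y: "y \<in> S" "y \<notin> {x, k x, finv k x}" using other[of "{x, k x, finv k x}"] by auto
  have yS: "k y \<in> S" using y(1) permutes_in_image[OF ks] by simp
  have ky: "k y \<noteq> x" "k y \<noteq> k x"
    using y(2) permutes_inverses[OF ks] permutes_inj[OF ks] by (auto dest: injD)
  have "k \<circ> (tsp x y \<circ> finv k \<circ> finv (tsp x y)) \<in> K"
    by (rule comp[OF k(1) conj[OF inv[OF k(1)]]]) (use xS y in \<open>auto intro: permutes_swap_id\<close>)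
  then have c: "tsp (k x) (k y) \<circ> tsp x y \<in> K"
    unfolding conj_transpose[OF permutes_bij[OF ks], symmetric] by (simp add: comp_assoc)
  \<comment> \<open>The commutator \<open>c\<close> is a 3-cycle or a product of two disjoint transpositions.\<close>
  have "\<exists>a b c. {a, b, c} \<subseteq> S \<and> distinct [a, b, c] \<and> tsp a b \<circ> tsp a c \<in> K"
  proof (cases "k y = y")
    case True
    then have "tsp y (k x) \<circ> tsp y x \<in> K" using c by (simp add: transpose_commute)
    moreover have "{y, k x, x} \<subseteq> S \<and> distinct [y, k x, x]" using xS y x by auto
    ultimately show ?thesis by blast
  next
    case False
    have "card {k x, k y, x, y} \<le> 4" by (simp add: card_insert_if)
    then obtain e where e: "e \<in> S" "e \<notin> {k x, k y, x, y}" using other[of "{k x, k y, x, y}"] by auto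
    let ?g = "tsp y e"
    have g: "?g permutes S" using e y by (auto intro: permutes_swap_id)
    have d: "distinct [k x, k y, x, y, e]" using x y ky False e by auto
    \<comment> \<open>Conjugating by the transposition of \<open>y\<close> and \<open>e\<close>
      alters only the second factor. In the product with the original the first factors cancel, and
      a 3-cycle remains.\<close>
    have "?g \<circ> (tsp (k x) (k y) \<circ> tsp x y) \<circ> finv ?g
        = (?g \<circ> tsp (k x) (k y) \<circ> finv ?g) \<circ> (?g \<circ> tsp x y \<circ> finv ?g)"
      by (simp add: fun_eq_iff)
    also have "\<dots> = tsp (k x) (k y) \<circ> tsp x e"
      unfolding conj_transpose[OF permutes_bij[OF g]] using d by (simp add: Transposition.transpose_def)
    finally have "(tsp (k x) (k y) \<circ> tsp x y) \<circ> (tsp (k x) (k y) \<circ> tsp x e) \<in> K"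
      using comp[OF c conj[OF c g]] by simp
    also have "(tsp (k x) (k y) \<circ> tsp x y) \<circ> (tsp (k x) (k y) \<circ> tsp x e)
        = tsp x y \<circ> tsp x e"
      using d by (auto simp: fun_eq_iff Transposition.transpose_def)
    finally have "tsp x y \<circ> tsp x e \<in> K" .
    moreover have "{x, y, e} \<subseteq> S \<and> distinct [x, y, e]" using d xS y e by auto
    ultimately show ?thesis by blast
  qed
  then obtain a b c where abc: "{a, b, c} \<subseteq> S" "distinct [a, b, c]" "tsp a b \<circ> tsp a c \<in> K"
    by blast
  have three: "tsp a' b' \<circ> tsp a' c' \<in> K" if S': "{a', b', c'} \<subseteq> S" and D': "distinct [a', b', c']" for a' b' c'
  proof -
    obtain g where g: "g permutes S" "g a = a'" "g b = b'" "g c = c'"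
      using ex_permutes_three[OF abc(2) D', of S] S' abc(1) by blast
    have "g \<circ> (tsp a b \<circ> tsp a c) \<circ> finv g
        = (g \<circ> tsp a b \<circ> finv g) \<circ> (g \<circ> tsp a c \<circ> finv g)"
      using permutes_inverses[OF g(1)] by (simp add: fun_eq_iff)
    then show ?thesis
      using conj[OF abc(3) g(1)] unfolding conj_transpose[OF permutes_bij[OF g(1)]] g by simp
  qed
  have two: "tsp a b \<circ> tsp c d \<in> K"
    if S: "a \<in> S" "b \<in> S" "c \<in> S" "d \<in> S" and "a \<noteq> b" "c \<noteq> d" for a b c d
  proof -
    consider "{a, b} = {c, d}" | "a = c" "b \<noteq> d" | "a = d" "b \<noteq> c" | "b = c" "a \<noteq> d" | "b = d" "a \<noteq> c"
      | "{a, b} \<inter> {c, d} = {}" by auto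
    then show ?thesis
    proof cases
      case 1
      then have "tsp a b = tsp c d" by (auto simp: doubleton_eq_iff transpose_commute)
      then show ?thesis using id by simp
    next
      case 2 then show ?thesis using three[of a b d] that by auto
    next
      case 3 then show ?thesis using three[of a b c] that by (auto simp: transpose_commute)
    next
      case 4 then show ?thesis using three[of b a d] that by (auto simp: transpose_commute)
    next
      case 5 then show ?thesis using three[of b a c] that by (auto simp: transpose_commute)
    next
      case 6
      \<comment> \<open>Disjoint transpositions are joined by inserting the transposition of
        \<open>b\<close> and \<open>c\<close> twice, which gives two 3-cycles.\<close>
      have "(tsp b a \<circ> tsp b c) \<circ> (tsp c b \<circ> tsp c d) \<in> K"
        by (rule comp[OF three three]) (use that 6 in auto)
      also have "(tsp b a \<circ> tsp b c) \<circ> (tsp c b \<circ> tsp c d) = tsp a b \<circ> tsp c d"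
        by (simp add: fun_eq_iff transpose_commute[of c b] transpose_commute[of b a])
      finally show ?thesis .
    qed
  qed
  \<comment> \<open>This replaces the sign: a permutation lies in \<open>K\<close>, or every
    transposition brings it there.\<close>
  have parity: "p \<in> K \<or> (\<forall>a\<in>S. \<forall>b\<in>S. a \<noteq> b \<longrightarrow> tsp a b \<circ> p \<in> K)" if "p permutes S" for p
    using that fin
  proof (induction p rule: permutes_induct)
    case id show ?case using \<open>id \<in> K\<close> by blast
  next
    case (swap a b p)
    show ?case
    proof (cases "a = b \<or> p \<notin> K")
      case True
      then show ?thesis using swap by blast
    next
      case False
      then have "tsp c d \<circ> (tsp a b \<circ> p) \<in> K" if "c \<in> S" "d \<in> S" "c \<noteq> d" for c d
        using comp[OF two[OF that(1,2) swap(1,2) that(3)]] False by (auto simp: comp_assoc)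
      then show ?thesis by blast
    qed
  qed
  show ?thesis
  proof (cases "q \<in> K")
    case True then show ?thesis by (rule comp[OF _ True])
  next
    case False
    let ?t = "tsp x (k x)"
    have t: "?t permutes S" using xS by (auto intro: permutes_swap_id)
    have tq: "?t \<circ> q \<in> K" using parity[OF q] False xS x by metis
    \<comment> \<open>Conjugation by \<open>?t\<close> turns \<open>?t \<circ> q\<close> into
      \<open>q \<circ> ?t\<close>, and the latter composed with the former is
      \<open>q \<circ> q\<close>.\<close>
    have "?t \<circ> (?t \<circ> q) \<circ> finv ?t \<in> K" by (rule conj[OF tq t])
    from comp[OF this tq] show ?thesis by (simp add: comp_def)
  qed
qed

section \<open>Periodic points and the faithful action\<close>

lemma tr_period_multiple:
  assumes "tr M y = y" shows "tr (M * k) y = y"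
proof (induction k rule: int_induct[of _ 0])
  case (step1 k)
  then show ?case using tr_tr[of M "M * k" y] assms by (simp add: distrib_left add.commute)
next
  case (step2 k)
  have "tr (- M) y = y" using tr_tr[of "- M" M y] assms by simp
  then show ?case using tr_tr[of "- M" "M * k" y] step2 by (simp add: right_diff_distrib)
qed simp

text \<open>\<open>M\<close> may be negative, because an isomorphism may send a positive power of
  the shift to a negative one.\<close>

definition fixed_confs :: "'a set \<Rightarrow> int \<Rightarrow> (int \<Rightarrow> 'a) set" where
  "fixed_confs A M = {y \<in> confs A. tr M y = y}"

lemma fixed_confs_inj:
  assumes "M \<noteq> 0"
  shows "inj_on (\<lambda>y. restrict y {0..<\<bar>M\<bar>}) (fixed_confs A M)"
proof (rule inj_onI)
  fix x y assume xy: "x \<in> fixed_confs A M" "y \<in> fixed_confs A M"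
    and eq: "restrict x {0..<\<bar>M\<bar>} = restrict y {0..<\<bar>M\<bar>}"
  have z: "z i = z (i mod \<bar>M\<bar>)" if "z \<in> fixed_confs A M" for z :: "int \<Rightarrow> 'a" and i
  proof -
    have "tr (M * (sgn M * (i div \<bar>M\<bar>))) z = z"
      using that by (intro tr_period_multiple) (simp add: fixed_confs_def)
    then have "z (i mod \<bar>M\<bar>) = z (i mod \<bar>M\<bar> + M * (sgn M * (i div \<bar>M\<bar>)))"
      by (metis tr_def)
    also have "M * (sgn M * (i div \<bar>M\<bar>)) = \<bar>M\<bar> * (i div \<bar>M\<bar>)"
      by (simp add: mult_sgn_abs abs_sgn mult.assoc[symmetric])
    finally show ?thesis by simp
  qed
  show "x = y"
  proof
    fix i
    have "i mod \<bar>M\<bar> \<in> {0..<\<bar>M\<bar>}" using assms by simp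
    then have "x (i mod \<bar>M\<bar>) = y (i mod \<bar>M\<bar>)" using eq by (metis restrict_apply')
    then show "x i = y i" using z[OF xy(1), of i] z[OF xy(2), of i] by simp
  qed
qed

lemma fixed_confs_card:
  assumes "finite A" "M \<noteq> 0"
  shows "finite (fixed_confs A M)" "card (fixed_confs A M) \<le> card A ^ nat \<bar>M\<bar>"
proof -
  let ?\<rho> = "\<lambda>y. restrict y {0..<\<bar>M\<bar>}"
  have im: "?\<rho> ` fixed_confs A M \<subseteq> words A \<bar>M\<bar>"
    by (auto simp: fixed_confs_def words_def confs_iff)
  show "finite (fixed_confs A M)"
    by (rule finite_imageD[OF finite_subset[OF im finite_words[OF assms(1)]] fixed_confs_inj[OF assms(2)]])
  show "card (fixed_confs A M) \<le> card A ^ nat \<bar>M\<bar>"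
    using card_inj_on_le[OF fixed_confs_inj[OF assms(2)] im finite_words[OF assms(1)]] by (simp add: card_words)
qed

text \<open>That \<open>f\<close> moves \<open>y\<close> at coordinate \<open>i\<close> is visible
  in a finite window, and points of every sufficiently large period agree with \<open>y\<close>
  there.\<close>

lemma SG_moves_fixed_conf:
  assumes B: "finite B" and f: "f \<in> carrier (SG B)" "f \<noteq> \<one>\<^bsub>SG B\<^esub>"
  shows "\<exists>T. \<forall>M. \<bar>M\<bar> \<ge> T \<longrightarrow> (\<exists>y\<in>fixed_confs B M. f y \<noteq> y)"
proof -
  interpret group "SG B" by (rule group_SG)
  obtain y where y: "y \<in> confs B" "f y \<noteq> y"
    using f SG_eqI[of f B "\<one>\<^bsub>SG B\<^esub>"] SG_one by fastforce
  then obtain i where i: "f y i \<noteq> y i" by blast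
  obtain r where r: "\<And>x y. \<lbrakk>x \<in> confs B; y \<in> confs B; \<And>j. \<bar>j\<bar> \<le> r \<Longrightarrow> x j = y j\<rbrakk> \<Longrightarrow> f x i = f y i"
    using continuous_map_window[OF B SG_continuous[OF f(1)]] by blast
  define R where "R = \<bar>r\<bar> + \<bar>i\<bar>"
  have "\<exists>z\<in>fixed_confs B M. f z \<noteq> z" if M: "\<bar>M\<bar> \<ge> 2 * R + 1" for M
  proof
    \<comment> \<open>\<open>z\<close> repeats the part of \<open>y\<close> that starts at
      \<open>- R\<close> and has length \<open>\<bar>M\<bar>\<close>. The length is at least
      \<open>2 * R + 1\<close>, so \<open>z\<close> agrees with \<open>y\<close> on the window and
      at \<open>i\<close>.\<close>
    define z where "z j = y ((j + R) mod \<bar>M\<bar> - R)" for j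
    have near: "z j = y j" if "\<bar>j\<bar> \<le> R" for j
    proof -
      have "(j + R) mod \<bar>M\<bar> = j + R" using that M by (intro mod_pos_pos_trivial) auto
      then show ?thesis by (simp add: z_def)
    qed
    have zB: "z \<in> confs B" using y(1) by (simp add: z_def confs_iff)
    have "(j + M + R) mod \<bar>M\<bar> = (j + R) mod \<bar>M\<bar>" for j
    proof -
      have "(j + M + R) mod \<bar>M\<bar> = (j + R + \<bar>M\<bar> * sgn M) mod \<bar>M\<bar>"
        by (simp add: abs_mult_sgn algebra_simps)
      then show ?thesis by simp
    qed
    then show "z \<in> fixed_confs B M" using zB by (simp add: fixed_confs_def tr_def z_def fun_eq_iff)
    have "f z i = f y i" by (rule r) (use zB y near in \<open>auto simp: R_def\<close>)
    then show "f z \<noteq> z" using i near[of i] by (auto simp: R_def)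
  qed
  then show ?thesis by blast
qed

section \<open>Letterwise and blockwise permutations as group elements\<close>

lemma letterwise_closed:
  assumes "bij_betw p A A"
  shows "restrict (\<lambda>x i. p (x i)) (confs A) \<in> carrier (SG A)"
proof (rule SG_restrictI[where k = 1])
  have q: "bij_betw (inv_into A p) A A" by (rule bij_betw_inv_into[OF assms])
  have dep: "\<exists>J. finite J \<and> (\<forall>x\<in>confs A. \<forall>y\<in>confs A. (\<forall>j\<in>J. x j = y j) \<longrightarrow> q (x i) = q (y i))"
    for q :: "'a \<Rightarrow> 'a" and i
    by (rule exI[of _ "{i}"]) simp
  show "homeomorphic_maps (full_shift A) (full_shift A) (\<lambda>x i. p (x i)) (\<lambda>x i. inv_into A p (x i))"
    by (rule homeomorphic_maps_finite_dependence)
      (use assms bij_betwE[OF assms] bij_betwE[OF q] dep in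
        \<open>auto simp: confs_iff bij_betw_inv_into_left bij_betw_inv_into_right\<close>)
qed (simp_all add: tr_def)

text \<open>The letterwise action of a permutation on words of even length is the square of
  \<open>(a, b) \<mapsto> (p b, a)\<close> on pairs, hence an even permutation of the words.\<close>
definition pair_twist :: "('a \<Rightarrow> 'a) \<Rightarrow> 'a set \<Rightarrow> int \<Rightarrow> (int \<Rightarrow> 'a) \<Rightarrow> int \<Rightarrow> 'a" where
  "pair_twist p A w u = (if u \<in> words A w
    then (\<lambda>r\<in>{0..<w}. if even r then p (u (r + 1)) else u (r - 1)) else u)"

text \<open>Since \<open>w\<close> is even, the pairs formed by an even position and its successor
  tile the block, so no partner falls outside.\<close>

lemma pair_twist_words:
  assumes "even w" "p \<in> A \<rightarrow> A" "u \<in> words A w"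
  shows "pair_twist p A w u \<in> words A w"
proof -
  have "r + 1 < w" if "r < w" "even r" for r
  proof -
    have "r + 1 \<noteq> w" using that assms(1) by auto
    then show ?thesis using that by simp
  qed
  moreover have "0 \<le> r - 1" if "0 \<le> r" "odd r" for r :: int
  proof -
    have "r \<noteq> 0" using that by auto
    then show ?thesis using that by simp
  qed
  ultimately show ?thesis using assms(2,3)
    by (auto simp: pair_twist_def words_def PiE_def Pi_def)
qed

lemma pair_twist_twice:
  assumes "even w" "p \<in> A \<rightarrow> A" "u \<in> words A w" "r \<in> {0..<w}"
  shows "pair_twist p A w (pair_twist p A w u) r = p (u r)"
proof -
  let ?v = "pair_twist p A w u"
  have v: "?v \<in> words A w" by (rule pair_twist_words[OF assms(1-3)])
  show ?thesis
  proof (cases "even r")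
    case True
    then have "r + 1 \<noteq> w" using assms(1) by auto
    then have "?v (r + 1) = u r" using True assms(3,4) by (simp add: pair_twist_def)
    moreover have "pair_twist p A w ?v r = p (?v (r + 1))"
      using True v assms(4) by (simp add: pair_twist_def[of p A w ?v])
    ultimately show ?thesis by simp
  next
    case False
    then have "r \<noteq> 0" by auto
    then have "?v (r - 1) = p (u r)" using False assms(3,4) by (simp add: pair_twist_def)
    moreover have "pair_twist p A w ?v r = ?v (r - 1)"
      using False v assms(4) by (simp add: pair_twist_def[of p A w ?v])
    ultimately show ?thesis by simp
  qed
qed

text \<open>Injectivity is read off from the square, which applies the injective \<open>p\<close> to
  each letter; finiteness does the rest.\<close>

lemma pair_twist_permutes:
  assumes "finite A" "bij_betw p A A" "even w"
  shows "pair_twist p A w permutes words A w"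
proof (rule bij_imp_permutes)
  have p: "p \<in> A \<rightarrow> A" using assms(2) by (auto dest: bij_betwE)
  have "inj_on (pair_twist p A w) (words A w)"
  proof (rule inj_onI)
    fix u v assume u: "u \<in> words A w" and v: "v \<in> words A w"
      and eq: "pair_twist p A w u = pair_twist p A w v"
    show "u = v"
    proof
      fix r
      show "u r = v r"
      proof (cases "r \<in> {0..<w}")
        case True
        then have "p (u r) = p (v r)"
          using pair_twist_twice[OF assms(3) p u True] pair_twist_twice[OF assms(3) p v True] eq by simp
        moreover have "u r \<in> A" "v r \<in> A" using u v True by (auto simp: words_def)
        ultimately show ?thesis using assms(2) by (auto simp: bij_betw_def dest: inj_onD)
      next
        case False
        then show ?thesis using u v by (auto simp: words_def PiE_def extensional_def)
      qed
    qed
  qed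
  moreover have "pair_twist p A w ` words A w \<subseteq> words A w"
    using pair_twist_words[OF assms(3) p] by blast
  ultimately show "bij_betw (pair_twist p A w) (words A w) (words A w)"
    using endo_inj_surj[OF finite_words[OF assms(1)]] by (simp add: bij_betw_def)
qed (simp add: pair_twist_def)

text \<open>Realises the permutations of the words of length \<open>w\<close> as group elements
  commuting with the \<open>w\<close>-th power of the shift.\<close>

definition block_perm :: "'a set \<Rightarrow> int \<Rightarrow> ((int \<Rightarrow> 'a) \<Rightarrow> int \<Rightarrow> 'a) \<Rightarrow> (int \<Rightarrow> 'a) \<Rightarrow> int \<Rightarrow> 'a" where
  "block_perm A w \<pi> = restrict (recode w w \<pi>) (confs A)"

lemma block_perm_closed:
  assumes "\<pi> permutes words A w" "0 < w"
  shows "block_perm A w \<pi> \<in> carrier (SG A)"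
  unfolding block_perm_def
proof (rule SG_restrictI[where k = "nat w"])
  show "homeomorphic_maps (full_shift A) (full_shift A) (recode w w \<pi>) (recode w w (inv_into (words A w) \<pi>))"
    using homeomorphic_maps_recode[OF permutes_imp_bij[OF assms(1)] assms(2,2)] .
qed (use assms(2) recode_tr[of w w \<pi> 1] in auto)

lemma block_perm_mult:
  assumes "\<pi> permutes words A w" "\<rho> permutes words A w" "0 < w"
  shows "block_perm A w (\<pi> \<circ> \<rho>) = block_perm A w \<pi> \<otimes>\<^bsub>SG A\<^esub> block_perm A w \<rho>"
proof -
  interpret group "SG A" by (rule group_SG)
  have \<rho>: "\<rho> \<in> words A w \<rightarrow> words A w" using permutes_in_image[OF assms(2)] by blast
  show ?thesis
  proof (rule SG_eqI[of _ A])
    fix x assume x: "x \<in> confs A"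
    then show "block_perm A w (\<pi> \<circ> \<rho>) x = (block_perm A w \<pi> \<otimes>\<^bsub>SG A\<^esub> block_perm A w \<rho>) x"
      using SG_mult[OF block_perm_closed[OF assms(1,3)] block_perm_closed[OF assms(2,3)] x]
        recode_in_confs[OF \<rho> assms(3) x] recode_recode[OF \<rho> x, of w \<pi>]
      by (simp add: block_perm_def)
  qed (use assms in \<open>auto intro: block_perm_closed permutes_compose\<close>)
qed

lemma block_perm_one:
  assumes "0 < w"
  shows "block_perm A w id = \<one>\<^bsub>SG A\<^esub>"
proof -
  interpret group "SG A" by (rule group_SG)
  show ?thesis
  proof (rule SG_eqI[of _ A])
    show "block_perm A w id \<in> carrier (SG A)" by (rule block_perm_closed[OF permutes_id assms])
  qed (use assms in \<open>auto simp: SG_one block_perm_def recode_ident\<close>)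
qed

lemma block_perm_commute:
  assumes "\<pi> permutes words A w" "0 < w"
  shows "block_perm A w \<pi> \<otimes>\<^bsub>SG A\<^esub> trs A w = trs A w \<otimes>\<^bsub>SG A\<^esub> block_perm A w \<pi>"
  unfolding trs_commute[OF block_perm_closed[OF assms]]
  using assms(2) recode_tr[of w w \<pi> 1] by (simp add: block_perm_def)

lemma iso_shift_power_card_le:
  assumes A: "finite A" "card A \<ge> 2" and B: "finite B"
    and \<Psi>: "\<Psi> \<in> iso (SG A) (SG B)"
    and PQ: "P \<ge> 1" "Q \<noteq> 0" "\<Psi> (trs A P) = trs B Q"
  shows "card A ^ nat P \<le> card B ^ nat \<bar>Q\<bar>"
proof -
  interpret GA: group "SG A" by (rule group_SG)
  interpret GB: group "SG B" by (rule group_SG)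
  interpret h: group_hom "SG A" "SG B" \<Psi>
    using \<Psi> by unfold_locales (simp add: iso_def)
  have inj: "inj_on \<Psi> (carrier (SG A))" using \<Psi> by (simp add: iso_def bij_betw_def)
  have \<Psi>_trs: "\<Psi> (trs A (P * int t)) = trs B (Q * int t)" for t
    using h.hom_nat_pow[of "trs A P" t] PQ(3) by (simp add: trs_pow)
  \<comment> \<open>\<open>l\<close> is fixed before \<open>t\<close>: it permutes blocks of any
    length, so the threshold \<open>T\<close> obtained from it does not depend on
    \<open>t\<close>.\<close>
  obtain p where p: "bij_betw p A A" "\<And>a. a \<in> A \<Longrightarrow> p a \<noteq> a"
    using ex_derangement[OF A] by blast
  define l where "l = restrict (\<lambda>x i. p (x i)) (confs A)"
  have l: "l \<in> carrier (SG A)" unfolding l_def by (rule letterwise_closed[OF p(1)])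
  have "l \<noteq> \<one>\<^bsub>SG A\<^esub>"
  proof
    assume "l = \<one>\<^bsub>SG A\<^esub>"
    obtain a where a: "a \<in> A" using A(2) by fastforce
    then have "(\<lambda>_. a) \<in> confs A" by (simp add: confs_iff)
    then have "l (\<lambda>_. a) = (\<lambda>_. a)" using \<open>l = \<one>\<^bsub>SG A\<^esub>\<close> by (simp add: SG_one)
    then have "p a = a" using \<open>(\<lambda>_. a) \<in> confs A\<close> by (simp add: l_def fun_eq_iff)
    then show False using p(2)[OF a] by simp
  qed
  then have "\<Psi> l \<noteq> \<one>\<^bsub>SG B\<^esub>"
    using inj_onD[OF inj, of l "\<one>\<^bsub>SG A\<^esub>"] l h.hom_one by auto
  then obtain T where T: "\<And>M. \<bar>M\<bar> \<ge> T \<Longrightarrow> \<exists>y\<in>fixed_confs B M. \<Psi> l y \<noteq> y"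
    using SG_moves_fixed_conf[OF B h.hom_closed[OF l]] by blast
  \<comment> \<open>The factor 4 makes \<open>w\<close> even, as \<open>pair_twist\<close> requires,
    and at least 4, so that there are at least 16 words; \<open>t\<close> also exceeds
    \<open>T\<close>, hence \<open>\<bar>M\<bar> \<ge> T\<close>.\<close>
  define t where "t = 4 * (nat T + 1)"
  define w where "w = P * int t"
  define M where "M = Q * int t"
  define S where "S = words A w"
  define Y where "Y = fixed_confs B M"
  have t: "t \<ge> 1" "int t \<ge> 4" "int t \<ge> T" "even (int t)" by (simp_all add: t_def)
  have "w \<ge> 1 * int t" unfolding w_def using PQ(1) by (intro mult_right_mono) auto
  then have w: "w \<ge> 4" "even w" "0 < w" using t(2,4) by (linarith, simp add: w_def, linarith)
  have "\<bar>M\<bar> \<ge> 1 * int t" unfolding M_def abs_mult using PQ(2) by (intro mult_mono) auto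
  then have M: "\<bar>M\<bar> \<ge> T" "M \<noteq> 0" using t by auto
  obtain y0 where y0: "y0 \<in> Y" "\<Psi> l y0 \<noteq> y0" using T[OF M(1)] by (auto simp: Y_def)
  have finS: "finite S" unfolding S_def by (rule finite_words[OF A(1)])
  have "(2::nat) ^ 4 \<le> card A ^ 4" using A(2) by (rule power_mono) simp
  also have "\<dots> \<le> card A ^ nat w" using A(2) w(1) by (intro power_increasing) auto
  finally have cardS: "card S \<ge> 5" by (simp add: S_def card_words)
  define act where "act \<pi> = \<Psi> (block_perm A w \<pi>)" for \<pi>
  have act_closed: "act \<pi> \<in> carrier (SG B)" if "\<pi> permutes S" for \<pi>
    unfolding act_def using that w(3) by (intro h.hom_closed block_perm_closed) (auto simp: S_def)
  have act_mult: "act (\<pi> \<circ> \<rho>) y = act \<pi> (act \<rho> y)"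
    if "\<pi> permutes S" "\<rho> permutes S" "y \<in> confs B" for \<pi> \<rho> y
  proof -
    have "act (\<pi> \<circ> \<rho>) = act \<pi> \<otimes>\<^bsub>SG B\<^esub> act \<rho>"
      unfolding act_def using that(1,2) w(3) by (simp add: block_perm_mult block_perm_closed S_def)
    then show ?thesis using SG_mult[OF act_closed[OF that(1)] act_closed[OF that(2)] that(3)] by simp
  qed
  have act_id: "act id y = y" if "y \<in> confs B" for y
    using that w(3) by (simp add: act_def block_perm_one SG_one)
  have YB: "y \<in> confs B" if "y \<in> Y" for y using that by (simp add: Y_def fixed_confs_def)
  have act_Y: "act \<pi> y \<in> Y" if \<pi>: "\<pi> permutes S" and y: "y \<in> Y" for \<pi> y
  proof -
    have b: "block_perm A w \<pi> \<in> carrier (SG A)"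
      using \<pi> w(3) by (intro block_perm_closed) (auto simp: S_def)
    \<comment> \<open>\<open>\<Psi>\<close> carries the \<open>w\<close>-th power of the shift to
      the \<open>M\<close>-th, so the image of a block permutation commutes with the latter and
      preserves its fixed points.\<close>
    have "\<Psi> (block_perm A w \<pi> \<otimes>\<^bsub>SG A\<^esub> trs A w) = \<Psi> (trs A w \<otimes>\<^bsub>SG A\<^esub> block_perm A w \<pi>)"
      using \<pi> w(3) by (simp add: block_perm_commute S_def)
    then have "act \<pi> \<otimes>\<^bsub>SG B\<^esub> trs B M = trs B M \<otimes>\<^bsub>SG B\<^esub> act \<pi>"
      using b \<Psi>_trs[of t] by (simp add: act_def w_def M_def)
    then have "act \<pi> (tr M y) = tr M (act \<pi> y)"
      using trs_commute[OF act_closed[OF \<pi>]] YB[OF y] by blast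
    then show ?thesis
      using y SG_in_confs[OF act_closed[OF \<pi>] YB[OF y]] by (simp add: Y_def fixed_confs_def)
  qed
  \<comment> \<open>The kernel of the action on the periodic points.\<close>
  define K where "K = {\<pi>. \<pi> permutes S \<and> (\<forall>y\<in>Y. act \<pi> y = y)}"
  have act_inv: "act (finv \<pi>) (act \<pi> y) = y" if "\<pi> permutes S" "y \<in> confs B" for \<pi> y
    using act_mult[OF permutes_inv[OF that(1)] that] permutes_inv_o(2)[OF that(1)] act_id[OF that(2)] by simp
  have act_inv': "act \<pi> (act (finv \<pi>) y) = y" if "\<pi> permutes S" "y \<in> confs B" for \<pi> y
    using act_mult[OF that(1) permutes_inv[OF that(1)] that(2)] permutes_inv_o(1)[OF that(1)] act_id[OF that(2)] by simp
  have K_trivial: "k = id" if "k \<in> K" for k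
  proof (rule ccontr)
    assume "k \<noteq> id"
    let ?\<gamma> = "pair_twist p A w"
    have \<gamma>: "?\<gamma> permutes S" unfolding S_def by (rule pair_twist_permutes[OF A(1) p(1) w(2)])
    have "?\<gamma> \<circ> ?\<gamma> \<in> K"
    proof (rule normal_permutations_square[OF finS cardS _ _ _ _ \<open>k \<in> K\<close> \<open>k \<noteq> id\<close> \<gamma>])
      fix \<pi> assume "\<pi> \<in> K"
      then have \<pi>: "\<pi> permutes S" "\<And>y. y \<in> Y \<Longrightarrow> act \<pi> y = y" by (auto simp: K_def)
      show "\<pi> permutes S" by (rule \<pi>)
      have "act (finv \<pi>) y = y" if "y \<in> Y" for y
        using act_inv[OF \<pi>(1) YB[OF that]] \<pi>(2)[OF that] by simp
      then show "finv \<pi> \<in> K" using permutes_inv[OF \<pi>(1)] by (simp add: K_def)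
      {
        fix \<rho> assume "\<rho> \<in> K"
        then have \<rho>: "\<rho> permutes S" "\<And>y. y \<in> Y \<Longrightarrow> act \<rho> y = y" by (auto simp: K_def)
        show "\<pi> \<circ> \<rho> \<in> K"
          using permutes_compose[OF \<rho>(1) \<pi>(1)] act_mult[OF \<pi>(1) \<rho>(1) YB] \<pi>(2) \<rho>(2) by (simp add: K_def)
      }
      fix \<rho> assume \<rho>: "\<rho> permutes S"
      have "act (\<rho> \<circ> \<pi> \<circ> finv \<rho>) y = y" if y: "y \<in> Y" for y
      proof -
        \<comment> \<open>\<open>Y\<close> is stable under the action, so \<open>\<pi>\<close> fixes
          this intermediate point; this makes the kernel normal.\<close>
        have i: "act (finv \<rho>) y \<in> Y" by (rule act_Y[OF permutes_inv[OF \<rho>] y])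
        have "act (\<rho> \<circ> \<pi> \<circ> finv \<rho>) y = act \<rho> (act \<pi> (act (finv \<rho>) y))"
          using act_mult[OF permutes_compose[OF \<pi>(1) \<rho>] permutes_inv[OF \<rho>] YB[OF y]]
            act_mult[OF \<rho> \<pi>(1) YB[OF i]] by simp
        then show ?thesis using \<pi>(2)[OF i] act_inv'[OF \<rho> YB[OF y]] by simp
      qed
      then show "\<rho> \<circ> \<pi> \<circ> finv \<rho> \<in> K"
        using permutes_compose[OF permutes_inv[OF \<rho>] permutes_compose[OF \<pi>(1) \<rho>]] by (simp add: K_def)
    qed
    \<comment> \<open>The square of the twist applies \<open>p\<close> at every position of a block,
      so the division into blocks disappears. Then \<open>\<Psi> l\<close> would fix
      \<open>Y\<close> pointwise, although it moves \<open>y0\<close>.\<close>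
    moreover have "block_perm A w (?\<gamma> \<circ> ?\<gamma>) = l"
    proof (rule SG_eqI[of _ A])
      show "block_perm A w (?\<gamma> \<circ> ?\<gamma>) \<in> carrier (SG A)"
        using permutes_compose[OF \<gamma> \<gamma>] w(3) by (intro block_perm_closed) (auto simp: S_def)
      fix x assume x: "x \<in> confs A"
      have pA: "p \<in> A \<rightarrow> A" using p(1) by (auto dest: bij_betwE)
      have "?\<gamma> (?\<gamma> (word w x (i div w))) (i mod w) = p (x i)" for i
        using pair_twist_twice[OF w(2) pA word_in_words[OF x], of "i mod w"] w(3) word_nth[OF w(3), of x i]
        by simp
      then show "block_perm A w (?\<gamma> \<circ> ?\<gamma>) x = l x"
        using x by (simp add: block_perm_def l_def recode_def)
    qed (rule l)
    ultimately show False using y0 by (auto simp: K_def act_def)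
  qed
  \<comment> \<open>Extending by the identity off \<open>Y\<close> gives genuine permutations of
    \<open>Y\<close>, which can be counted.\<close>
  define rep where "rep \<pi> y = (if y \<in> Y then act \<pi> y else y)" for \<pi> y
  have finY: "finite Y" and cardY: "card Y \<le> card B ^ nat \<bar>M\<bar>"
    unfolding Y_def by (rule fixed_confs_card[OF B M(2)])+
  have rep_permutes: "rep \<pi> permutes Y" if \<pi>: "\<pi> permutes S" for \<pi>
  proof (rule bij_imp_permutes)
    have "inj_on (rep \<pi>) Y"
      using SG_inj[OF act_closed[OF \<pi>]] YB by (auto simp: rep_def inj_on_def)
    moreover have "rep \<pi> ` Y \<subseteq> Y" using act_Y[OF \<pi>] by (auto simp: rep_def)
    ultimately show "bij_betw (rep \<pi>) Y Y"
      using endo_inj_surj[OF finY] by (simp add: bij_betw_def)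
  qed (simp add: rep_def)
  have "inj_on rep {\<pi>. \<pi> permutes S}"
  proof (rule inj_onI)
    fix \<pi> \<rho> assume "\<pi> \<in> {\<pi>. \<pi> permutes S}" "\<rho> \<in> {\<pi>. \<pi> permutes S}" and eq: "rep \<pi> = rep \<rho>"
    then have \<pi>: "\<pi> permutes S" and \<rho>: "\<rho> permutes S" by simp_all
    have "act (finv \<rho> \<circ> \<pi>) y = y" if y: "y \<in> Y" for y
    proof -
      have "act \<pi> y = act \<rho> y" using fun_cong[OF eq, of y] y by (simp add: rep_def)
      then show ?thesis
        using act_mult[OF permutes_inv[OF \<rho>] \<pi> YB[OF y]] act_inv[OF \<rho> YB[OF y]] by simp
    qed
    then have "finv \<rho> \<circ> \<pi> = id"
      using permutes_compose[OF \<pi> permutes_inv[OF \<rho>]] by (intro K_trivial) (simp add: K_def)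
    then have "\<rho> \<circ> (finv \<rho> \<circ> \<pi>) = \<rho>" by simp
    then show "\<pi> = \<rho>" using permutes_inv_o(1)[OF \<rho>] by (simp add: comp_assoc[symmetric])
  qed
  then have "card {\<pi>. \<pi> permutes S} \<le> card {\<pi>. \<pi> permutes Y}"
    using rep_permutes finite_permutations[OF finY] by (intro card_inj_on_le) auto
  then have "(fact (card S) :: nat) \<le> fact (card Y)"
    using card_permutations[OF refl finS] card_permutations[OF refl finY] by simp
  \<comment> \<open>\<open>fact\<close> takes the same value at 0 and 1 and increases strictly from
    1 on, so \<open>Y\<close> has to be nonempty; \<open>y0\<close> witnesses this.\<close>
  moreover have "card Y > 0" using y0(1) finY by (auto simp: card_gt_0_iff)
  ultimately have "card S \<le> card Y"
    using fact_less_mono[of "card Y" "card S", where 'a = nat] by (metis not_le)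
  then have "card A ^ nat w \<le> card B ^ nat \<bar>M\<bar>" using cardY by (simp add: S_def card_words)
  moreover have "nat w = nat P * t" "nat \<bar>M\<bar> = nat \<bar>Q\<bar> * t"
    using PQ(1) by (simp_all add: w_def M_def abs_mult nat_mult_distrib)
  ultimately have "(card A ^ nat P) ^ t \<le> (card B ^ nat \<bar>Q\<bar>) ^ t"
    by (simp add: power_mult)
  then show ?thesis using t(1) by simp
qed

theorem corollary3:
  fixes A :: "'a set" and B :: "'b set" and m n :: nat
  assumes "m \<ge> 2" and "n \<ge> 2"
    and "card A = m" and "card B = n"
  shows "stab_Aut_group (full_shift A) shift \<cong> stab_Aut_group (full_shift B) shift
    \<longleftrightarrow> (\<exists>k j. k \<ge> 1 \<and> j \<ge> 1 \<and> m ^ k = n ^ j)"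
proof
  have A: "finite A" "card A \<ge> 2" and B: "finite B" "card B \<ge> 2"
    using assms by (auto intro: card_ge_0_finite)
  assume "SG A \<cong> SG B"
  then obtain \<Psi> where \<Psi>: "\<Psi> \<in> iso (SG A) (SG B)" by (auto simp: is_iso_def)
  define \<Phi> where "\<Phi> = inv_into (carrier (SG A)) \<Psi>"
  have \<Phi>: "\<Phi> \<in> iso (SG B) (SG A)"
    unfolding \<Phi>_def by (rule group.iso_set_sym[OF group_SG \<Psi>])
  interpret h: group_hom "SG B" "SG A" \<Phi>
    using \<Phi> by (intro group_hom.intro group_SG) (simp add: group_hom_axioms_def iso_def)
  obtain P Q where PQ: "P \<ge> 1" "Q \<noteq> 0" "\<Psi> (trs A P) = trs B Q"
    using iso_maps_shift_power[OF A B \<Psi>] by blast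
  have le: "m ^ nat P \<le> n ^ nat \<bar>Q\<bar>"
    using iso_shift_power_card_le[OF A B(1) \<Psi> PQ] assms by simp
  have inj: "inj_on \<Psi> (carrier (SG A))" using \<Psi> by (simp add: iso_def bij_betw_def)
  have \<Phi>Q: "\<Phi> (trs B Q) = trs A P"
    unfolding \<Phi>_def PQ(3)[symmetric] by (rule inv_into_f_f[OF inj trs_closed])
  \<comment> \<open>\<open>iso_shift_power_card_le\<close> wants a positive exponent in the source.
    For negative \<open>Q\<close>, inverting both sides moves the sign to the target exponent, where
    only the absolute value counts.\<close>
  have "\<exists>e. \<bar>e\<bar> = P \<and> \<Phi> (trs B \<bar>Q\<bar>) = trs A e"
  proof (cases "Q > 0")
    case True
    then show ?thesis using \<Phi>Q PQ(1) by (intro exI[of _ P]) simp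
  next
    case False
    have "\<Phi> (trs B (- Q)) = trs A (- P)"
      using h.hom_inv[of "trs B Q"] \<Phi>Q by (simp add: trs_inv)
    then show ?thesis using False PQ(1) by (intro exI[of _ "- P"]) simp
  qed
  then obtain e where e: "\<bar>e\<bar> = P" "\<Phi> (trs B \<bar>Q\<bar>) = trs A e" by blast
  have "\<bar>Q\<bar> \<ge> 1" "e \<noteq> 0" using PQ(1,2) e(1) by auto
  then have "n ^ nat \<bar>Q\<bar> \<le> m ^ nat P"
    using iso_shift_power_card_le[OF B A(1) \<Phi> _ _ e(2)] e(1) assms by simp
  then have "m ^ nat P = n ^ nat \<bar>Q\<bar>" using le by simp
  moreover have "nat P \<ge> 1" "nat \<bar>Q\<bar> \<ge> 1" using PQ(1) \<open>\<bar>Q\<bar> \<ge> 1\<close> by simp_all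
  ultimately show "\<exists>k j. k \<ge> 1 \<and> j \<ge> 1 \<and> m ^ k = n ^ j" by blast
next
  have fin: "finite A" "finite B" using assms by (auto intro: card_ge_0_finite)
  assume "\<exists>k j. k \<ge> 1 \<and> j \<ge> 1 \<and> m ^ k = n ^ j"
  then obtain k j where kj: "k \<ge> 1" "j \<ge> 1" "m ^ k = n ^ j" by blast
  \<comment> \<open>Equality of the powers says that there are as many \<open>k\<close>-blocks over
    \<open>A\<close> as \<open>j\<close>-blocks over \<open>B\<close>; any bijection between them is
    a recoding.\<close>
  have "card (words A (int k)) = card (words B (int j))"
    using kj(3) assms by (simp add: card_words)
  then obtain e where "bij_betw e (words A (int k)) (words B (int j))"
    using finite_same_card_bij[OF finite_words[OF fin(1)] finite_words[OF fin(2)]] by blast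
  then show "SG A \<cong> SG B" by (rule iso_of_recoding) (use kj in simp_all)
qed

end
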